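(* Let $\mathcal X\subset\mathbb R^d$ be a nonempty closed convex set and let $h$ be its indicator function, so that the problem is $\min_{x\in\mathcal X}f(x)$ and $\psi=f+h$. Suppose: (1) $f$ is $(\rho,Q)$-weakly convex for some $\rho>0$ and $Q=\mathrm{diag}(q)$ with $q\in\mathbb R^d_{++}$, and $\psi^*=\min_{x\in\mathbb R^d}\psi(x)$ is finite; (2) $(\Omega,\mathcal F,P)$ is a probability space from which i.i.d. realizations $\xi_0,\xi_1,\ldots\sim P$ can be generated, and there are an open set $U\supset\mathrm{dom}\,h=\mathcal X$ and a measurable map $G:U\times\Omega\to\mathbb R^d$ with $\mathbb E_\xi[G(x,\xi)]\in\partial f(x)$ for all $x\in U$; (3) $\|G(x,\xi)\|_\infty\le G_\infty$ for all $x\in\mathcal X$, $\xi\in\Omega$, and $\|x-y\|_\infty\le D_\infty$ for all $x,y\in\mathcal X$. Let $\beta_1,\beta_2,\beta_3\in[0,1)$ with $\tau=\beta_1/\sqrt{\beta_2}<1$, let $\pi\in(0,1)$ and $\alpha>0$, and for each positive integer $T$ set $\alpha_t=\alpha/\sqrt{T+1}$ for $0\le t\le T$, $\beta_{1,t}=\beta_1\pi^{t-1}$ for $1\le t\le T$, and $0\le\beta_{1,0}\le\beta_1$. Then for $x_{t^*}$ generated by the algorithm FEMA (described in the context), $$\mathbb E\Big[\big\|\nabla\psi_{1/(2\rho),\widehat V_{t^*}^{1/2}}(x_{t^*})\big\|^2\Big]\le O\Big(\frac{d}{\sqrt T}\Big).$$ Here $O(\cdot)$ means an upper bound by a constant times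 the displayed quantity, the dependence on $T$ and $d$ being explicit, and the constant depending only on the remaining parameters ($\rho,\alpha,\pi,\beta_1,\beta_2,\beta_3,D_\infty,G_\infty$, the entries' bounds of $q$, and $\Delta_\psi=\psi_{1/(2\rho),\widehat V_{-1}^{1/2}}(x_0)-\psi^*$).
   Context: Vector operations (square, square root, maximum) are elementwise; $\|\cdot\|,\|\cdot\|_\infty$ are the $\ell_2,\ell_\infty$ norms. Weak convexity: for a symmetric positive definite $Q$ and $\rho\in\mathbb R$, a function $\phi:\mathbb R^d\to\mathbb R\cup\{+\infty\}$ is $(\rho,Q)$-weakly convex if $x\mapsto\phi(x)+\frac\rho2\|Q^{1/2}x\|^2$ is convex. $\partial\phi(x)$ denotes the Fréchet subdifferential: the set of $w$ with $\phi(y)\ge\phi(x)+\langle w,y-x\rangle+o(\|Q^{1/2}(y-x)\|)$ as $y\to x$ (empty if $x\notin\mathrm{dom}\,\phi$). Scaled Moreau envelope and proximal map: for $\zeta>0$ and a symmetric positive definite matrix $A$, $\phi_{\zeta,A}(x)=\min_y\{\phi(y)+\frac1{2\zeta}\|A^{1/2}(x-y)\|^2\}$ and $\mathrm{prox}_{\zeta\phi,A}(x)=\arg\min_y\{\phi(y)+\frac1{2\zeta}\|A^{1/2}(x-y)\|^2\}$. The gradient of the envelope is $\nabla\phi_{\zeta,A}(x)=\zeta^{-1}A(x-\mathrm{prox}_{\zeta\phi,A}(x))$. Algorithm FEMA. Input: $x_0\in\mathrm{dom}\,h$, $T$, stepsizes $\{\alpha_t\}_{t=0}^T$, parameters $\{\beta_{1,t}\}_{t=0}^T,\beta_2,\beta_3\in[0,1)$,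 and the vector $q$ from the weak convexity assumption. Initialize $m_{-1}=\upsilon_{-1}=0$, $\widehat\upsilon_{-1}=q$, $\widehat V_{-1}=\mathrm{diag}(\widehat\upsilon_{-1})$. For $t=0,\dots,T$: draw $\xi_t\sim P$ and set $g_t=G(x_t,\xi_t)$; $m_t=\beta_{1,t}m_{t-1}+(1-\beta_{1,t})g_t$; $\upsilon_t=\beta_2\upsilon_{t-1}+(1-\beta_2)g_t^2$; $\widehat\upsilon_t=\beta_3\widehat\upsilon_{t-1}+(1-\beta_3)\max(\widehat\upsilon_{t-1},\upsilon_t)$; $\widehat V_t=\mathrm{diag}(\widehat\upsilon_t)$; $x_{t+1}=\mathrm{prox}_{\alpha_th,\widehat V_t^{1/2}}\big(x_t-\alpha_t\widehat V_t^{-1/2}m_t\big)$. Output: $x_{t^*}$, where $t^*\in\{0,\dots,T\}$ is chosen with $\mathbb P(t^*=t)=\alpha_t/\sum_{s=0}^T\alpha_s$. When $h$ is the indicator of $\mathcal X$ the prox step is the projection onto $\mathcal X$ in the norm $\|\widehat V_t^{1/4}\cdot\|$. The expectation is over the samples $\xi_0,\dots,\xi_T$ and $t^*$.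
   Formalization: The formal theorem additionally requires the entries of q to have an upper bound below 4 (Q < 2 Q^{1/2}), so that the envelope with parameter 1/(2ρ) is differentiable; otherwise the claim fails, e.g. X=[-1,1], q=16, ρ=0.1, f(y)=-0.8y², x_0=0. It also takes β_2>0, so that τ is defined. *)

theory Defs
  imports "HOL-Probability.Probability"
begin

text \<open>
  \<open>\<real>\<^sup>d\<close> is the set of sequences vanishing from index \<open>d\<close> on, so that \<open>d\<close> can be quantified
  inside a formula. The topology and Borel sets that it inherits from the product topology on
  \<^typ>\<open>nat \<Rightarrow> real\<close> are the Euclidean ones. Its \<open>\<ell>\<^sub>2\<close> norm is \<open>L2_set x {..<d}\<close>.
\<close>

definition Rd :: "nat \<Rightarrow> (nat \<Rightarrow> real) set" where
  "Rd d = {x. \<forall>i\<ge>d. x i = 0}"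

definition dot :: "nat \<Rightarrow> (nat \<Rightarrow> real) \<Rightarrow> (nat \<Rightarrow> real) \<Rightarrow> real" where
  "dot d x y = (\<Sum>i<d. x i * y i)"

definition linf :: "nat \<Rightarrow> (nat \<Rightarrow> real) \<Rightarrow> real" where
  "linf d x = (MAX i\<in>{..<d}. \<bar>x i\<bar>)"

text \<open>
  A diagonal matrix \<open>A = diag a\<close> is represented by the vector \<open>a\<close>;
  \<open>wnorm d a x\<close> is \<open>\<parallel>A\<^sup>1\<^sup>/\<^sup>2 x\<parallel>\<close>.
\<close>

definition wnorm :: "nat \<Rightarrow> (nat \<Rightarrow> real) \<Rightarrow> (nat \<Rightarrow> real) \<Rightarrow> real" where
  "wnorm d a x = L2_set (\<lambda>i. sqrt (a i) * x i) {..<d}"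

definition convex_set :: "(nat \<Rightarrow> real) set \<Rightarrow> bool" where
  "convex_set X \<longleftrightarrow>
     (\<forall>x\<in>X. \<forall>y\<in>X. \<forall>t\<in>{0..1}. (\<lambda>i. (1 - t) * x i + t * y i) \<in> X)"

text \<open>Convexity for functions with values in \<open>\<real> \<union> {+\<infinity>}\<close>; \<open>0 < t < 1\<close> avoids \<open>0 * \<infinity>\<close>.\<close>

definition convex_fun :: "nat \<Rightarrow> ((nat \<Rightarrow> real) \<Rightarrow> ereal) \<Rightarrow> bool" where
  "convex_fun d \<phi> \<longleftrightarrow>
     (\<forall>x\<in>Rd d. \<forall>y\<in>Rd d. \<forall>t\<in>{0<..<1}.
        \<phi> (\<lambda>i. (1 - t) * x i + t * y i) \<le> ereal (1 - t) * \<phi> x + ereal t * \<phi> y)"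

definition weakly_convex ::
  "nat \<Rightarrow> real \<Rightarrow> (nat \<Rightarrow> real) \<Rightarrow> ((nat \<Rightarrow> real) \<Rightarrow> ereal) \<Rightarrow> bool" where
  "weakly_convex d \<rho> q \<phi> \<longleftrightarrow>
     (\<forall>x\<in>Rd d. \<phi> x \<noteq> -\<infinity>) \<and>
     convex_fun d (\<lambda>x. \<phi> x + ereal (\<rho> / 2 * (wnorm d q x)\<^sup>2))"

definition frechet_subdiff ::
  "nat \<Rightarrow> (nat \<Rightarrow> real) \<Rightarrow> ((nat \<Rightarrow> real) \<Rightarrow> ereal) \<Rightarrow> (nat \<Rightarrow> real) \<Rightarrow> (nat \<Rightarrow> real) set" where
  "frechet_subdiff d q \<phi> x =
     {w \<in> Rd d. \<phi> x \<noteq> \<infinity> \<and>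
        (\<forall>\<epsilon>>0. \<forall>\<^sub>F y in at x within Rd d.
           \<phi> y \<ge> \<phi> x + ereal (dot d w (\<lambda>i. y i - x i) - \<epsilon> * wnorm d q (\<lambda>i. y i - x i)))}"

definition indicator_fun :: "(nat \<Rightarrow> real) set \<Rightarrow> (nat \<Rightarrow> real) \<Rightarrow> ereal" where
  "indicator_fun X x = (if x \<in> X then 0 else \<infinity>)"

definition moreau_env ::
  "nat \<Rightarrow> ((nat \<Rightarrow> real) \<Rightarrow> ereal) \<Rightarrow> real \<Rightarrow> (nat \<Rightarrow> real) \<Rightarrow> (nat \<Rightarrow> real) \<Rightarrow> ereal" where
  "moreau_env d \<phi> \<zeta> a x =
     (INF y\<in>Rd d. \<phi> y + ereal (1 / (2 * \<zeta>) * (wnorm d a (\<lambda>i. x i - y i))\<^sup>2))"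

definition prox ::
  "nat \<Rightarrow> ((nat \<Rightarrow> real) \<Rightarrow> ereal) \<Rightarrow> real \<Rightarrow> (nat \<Rightarrow> real) \<Rightarrow> (nat \<Rightarrow> real) \<Rightarrow> (nat \<Rightarrow> real)" where
  "prox d \<phi> \<zeta> a x =
     arg_min (\<lambda>y. \<phi> y + ereal (1 / (2 * \<zeta>) * (wnorm d a (\<lambda>i. x i - y i))\<^sup>2)) (\<lambda>y. y \<in> Rd d)"

definition has_gradient ::
  "nat \<Rightarrow> ((nat \<Rightarrow> real) \<Rightarrow> real) \<Rightarrow> (nat \<Rightarrow> real) \<Rightarrow> (nat \<Rightarrow> real) \<Rightarrow> bool" where
  "has_gradient d F w x \<longleftrightarrow> w \<in> Rd d \<and>
     ((\<lambda>y. (F y - F x - dot d w (\<lambda>i. y i - x i)) / L2_set (\<lambda>i. y i - x i) {..<d})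
        \<longlongrightarrow> 0) (at x within Rd d)"

definition gradient ::
  "nat \<Rightarrow> ((nat \<Rightarrow> real) \<Rightarrow> real) \<Rightarrow> (nat \<Rightarrow> real) \<Rightarrow> (nat \<Rightarrow> real)" where
  "gradient d F x = (THE w. has_gradient d F w x)"

definition grad_env ::
  "nat \<Rightarrow> ((nat \<Rightarrow> real) \<Rightarrow> ereal) \<Rightarrow> real \<Rightarrow> (nat \<Rightarrow> real) \<Rightarrow> (nat \<Rightarrow> real) \<Rightarrow> (nat \<Rightarrow> real)" where
  "grad_env d \<phi> \<zeta> a = gradient d (\<lambda>x. real_of_ereal (moreau_env d \<phi> \<zeta> a x))"

text \<open>
  The state with index \<open>t\<close> is \<open>(x\<^sub>t, m\<^sub>t\<^sub>-\<^sub>1, u\<^sub>t\<^sub>-\<^sub>1, v\<^sub>t\<^sub>-\<^sub>1)\<close>, where \<open>u\<close> is the second-moment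
  average and \<open>v\<close> the vector on the diagonal of the preconditioner; \<open>xi\<close> is the
  realized sample sequence.
\<close>

primrec fema_state ::
  "nat \<Rightarrow> ((nat \<Rightarrow> real) \<Rightarrow> ereal) \<Rightarrow> ((nat \<Rightarrow> real) \<Rightarrow> 'a \<Rightarrow> (nat \<Rightarrow> real)) \<Rightarrow> (nat \<Rightarrow> real) \<Rightarrow>
   (nat \<Rightarrow> real) \<Rightarrow> (nat \<Rightarrow> real) \<Rightarrow> real \<Rightarrow> real \<Rightarrow> (nat \<Rightarrow> real) \<Rightarrow> (nat \<Rightarrow> 'a) \<Rightarrow> nat \<Rightarrow>
   (nat \<Rightarrow> real) \<times> (nat \<Rightarrow> real) \<times> (nat \<Rightarrow> real) \<times> (nat \<Rightarrow> real)" where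
  "fema_state d h G q \<alpha> \<beta>\<^sub>1 \<beta>\<^sub>2 \<beta>\<^sub>3 x\<^sub>0 xi 0 = (x\<^sub>0, (\<lambda>_. 0), (\<lambda>_. 0), q)"
| "fema_state d h G q \<alpha> \<beta>\<^sub>1 \<beta>\<^sub>2 \<beta>\<^sub>3 x\<^sub>0 xi (Suc t) =
     (let (x, m, u, v) = fema_state d h G q \<alpha> \<beta>\<^sub>1 \<beta>\<^sub>2 \<beta>\<^sub>3 x\<^sub>0 xi t;
          g = G x (xi t);
          m' = (\<lambda>i. \<beta>\<^sub>1 t * m i + (1 - \<beta>\<^sub>1 t) * g i);
          u' = (\<lambda>i. \<beta>\<^sub>2 * u i + (1 - \<beta>\<^sub>2) * (g i)\<^sup>2);
          v' = (\<lambda>i. \<beta>\<^sub>3 * v i + (1 - \<beta>\<^sub>3) * max (v i) (u' i));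
          x' = prox d h (\<alpha> t) (\<lambda>i. sqrt (v' i)) (\<lambda>i. x i - \<alpha> t * m' i / sqrt (v' i))
      in (x', m', u', v'))"

definition fema_x where
  "fema_x d h G q \<alpha> \<beta>\<^sub>1 \<beta>\<^sub>2 \<beta>\<^sub>3 x\<^sub>0 xi t = fst (fema_state d h G q \<alpha> \<beta>\<^sub>1 \<beta>\<^sub>2 \<beta>\<^sub>3 x\<^sub>0 xi t)"

definition fema_v where
  "fema_v d h G q \<alpha> \<beta>\<^sub>1 \<beta>\<^sub>2 \<beta>\<^sub>3 x\<^sub>0 xi t =
     snd (snd (snd (fema_state d h G q \<alpha> \<beta>\<^sub>1 \<beta>\<^sub>2 \<beta>\<^sub>3 x\<^sub>0 xi (Suc t))))"

definition stoch_subgradient_oracle ::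
  "nat \<Rightarrow> (nat \<Rightarrow> real) \<Rightarrow> ((nat \<Rightarrow> real) \<Rightarrow> ereal) \<Rightarrow> (nat \<Rightarrow> real) set \<Rightarrow> 'a measure \<Rightarrow>
   ((nat \<Rightarrow> real) \<Rightarrow> 'a \<Rightarrow> (nat \<Rightarrow> real)) \<Rightarrow> bool" where
  "stoch_subgradient_oracle d q f U P G \<longleftrightarrow>
     (\<forall>x\<in>U. \<forall>s\<in>space P. G x s \<in> Rd d) \<and>
     (\<lambda>(x, s). G x s) \<in> measurable (restrict_space borel U \<Otimes>\<^sub>M P) borel \<and>
     (\<forall>x\<in>U. (\<forall>i<d. integrable P (\<lambda>s. G x s i)) \<and>
        (\<lambda>i. \<integral>s. G x s i \<partial>P) \<in> frechet_subdiff d q f x)"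

text \<open>
  The samples \<open>\<xi> 0, \<dots>, \<xi> T\<close> are i.i.d. with law \<open>P\<close>, and the output index is independent
  of them, with probabilities proportional to the stepsizes.
\<close>

definition fema_randomness ::
  "nat \<Rightarrow> (nat \<Rightarrow> real) \<Rightarrow> 'a measure \<Rightarrow> 'w measure \<Rightarrow> (nat \<Rightarrow> 'w \<Rightarrow> 'a) \<Rightarrow> ('w \<Rightarrow> nat) \<Rightarrow> bool" where
  "fema_randomness T \<alpha> P M \<xi> ts \<longleftrightarrow>
     prob_space M \<and>
     prob_space.indep_vars M (\<lambda>_. P) \<xi> {..T} \<and>
     (\<forall>t\<le>T. distr M P (\<xi> t) = P) \<and>
     ts \<in> measurable M (count_space UNIV) \<and>
     (\<forall>\<omega>\<in>space M. ts \<omega> \<le> T) \<and>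
     (\<forall>t\<le>T. measure M {\<omega> \<in> space M. ts \<omega> = t} = \<alpha> t / (\<Sum>s\<le>T. \<alpha> s)) \<and>
     prob_space.indep_set M {ts -` A \<inter> space M | A. A \<in> UNIV}
       {(\<lambda>\<omega>. \<lambda>t\<in>{..T}. \<xi> t \<omega>) -` B \<inter> space M | B. B \<in> sets (PiM {..T} (\<lambda>_. P))}"

end

theory Submission
  imports Defs
begin

text \<open>
  Because the iterates stay in the compact set \<open>X\<close>, the constraint replaces every coercivity argument,
  and because \<open>\<beta>\<^sub>1\<^sub>t\<close> is summable, replacing \<open>m\<^sub>t\<close> by \<open>g\<^sub>t\<close> costs only \<open>O(d)\<close> in total.
  The Lyapunov function is the Moreau envelope at \<open>x\<^sub>t\<close> in the metric \<open>a\<^sub>t\<^sub>-\<^sub>1 = \<surd>v\<^sub>t\<^sub>-\<^sub>1\<close> of the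
  \<^emph>\<open>previous\<close> step: its proximal point \<open>p\<^sub>t\<close> is independent of \<open>\<xi>\<^sub>t\<close>, so the conditional expectation
  of \<open>\<langle>g\<^sub>t, p\<^sub>t - x\<^sub>t\<rangle>\<close> is governed by the subgradient inequality and is at most a negative multiple of
  \<open>\<parallel>x\<^sub>t - p\<^sub>t\<parallel>\<^sup>2\<close> in the metric \<open>a\<^sub>t\<^sub>-\<^sub>1\<close>. The price of switching metrics, both here and in the gradient of
  the envelope, is bounded by \<open>D\<^sub>\<infinity>\<^sup>2 \<Sum>\<^sub>i (a\<^sub>t\<^sub>i - a\<^sub>t\<^sub>-\<^sub>1\<^sub>i)\<close>, which telescopes since \<open>v\<^sub>t\<close> is nondecreasing.
\<close>

section \<open>Proximal maps of weakly convex functions on a compact set\<close>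

text \<open>The envelope lives in the moving metric a, while weak convexity is measured by
  \<open>q\<close>. With parameter 1/(2\<rho>) the proximal objective has curvature \<rho>(2a - q)
  in each coordinate. Since a \<ge> sqrt q, this dominates \<rho>(2 - sqrt qhi)a, which is positive
  because \<open>qhi < 2 * sqrt qhi\<close>; hence the denominator 2 - sqrt qhi in the final
  constant. Quadratic growth around the minimizer is the source of the other facts: stability of the
  proximal point jointly in point and metric, the gradient formula, and the negative angle with the
  subgradient. As \<open>prox\<close> is a choice operator applied to random data, this joint
  stability is also what yields its measurability. The descent estimates hold path by path; the
  oracle's mean enters through a single Fubini step. The function f may be infinite off X, so f + h
  is represented by \<open>ext_fun X \<phi>\<close> with \<phi> real-valued; on X finiteness follows
  from the existence of a Frechet subgradient.\<close>

definition ext_fun :: "(nat \<Rightarrow> real) set \<Rightarrow> ((nat \<Rightarrow> real) \<Rightarrow> real) \<Rightarrow> (nat \<Rightarrow> real) \<Rightarrow> ereal" where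
  "ext_fun X \<phi> y = (if y \<in> X then ereal (\<phi> y) else \<infinity>)"

text \<open>Weights may be negative: the curvature \<open>a i / \<zeta> - c i\<close> and the
  difference of two metrics are both treated as weights.\<close>

definition wsq :: "nat \<Rightarrow> (nat \<Rightarrow> real) \<Rightarrow> (nat \<Rightarrow> real) \<Rightarrow> (nat \<Rightarrow> real) \<Rightarrow> real" where
  "wsq d a x y = (\<Sum>i<d. a i * (x i - y i)\<^sup>2)"

section \<open>Arithmetic of weighted squared distances\<close>

lemma wsq_nonneg: "(\<And>i. i < d \<Longrightarrow> 0 \<le> a i) \<Longrightarrow> 0 \<le> wsq d a x y"
  unfolding wsq_def by (intro sum_nonneg mult_nonneg_nonneg) auto

lemma wsq_commute: "wsq d a x y = wsq d a y x"
  unfolding wsq_def by (simp add: power2_commute)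

lemma wsq_self [simp]: "wsq d a x x = 0"
  unfolding wsq_def by simp

lemma wsq_mono: "(\<And>i. i < d \<Longrightarrow> a i \<le> b i) \<Longrightarrow> wsq d a x y \<le> wsq d b x y"
  unfolding wsq_def by (intro sum_mono mult_right_mono) auto

lemma wsq_scale: "wsq d (\<lambda>i. s * a i) x y = s * wsq d a x y"
  unfolding wsq_def by (simp add: sum_distrib_left mult.assoc)

lemma wsq_diff: "wsq d (\<lambda>i. a i - b i) x y = wsq d a x y - wsq d b x y"
  unfolding wsq_def by (simp add: sum_subtractf algebra_simps)

lemma wsq_le_sum:
  assumes "\<And>i. i < d \<Longrightarrow> 0 \<le> a i" "\<And>i. i < d \<Longrightarrow> \<bar>x i - y i\<bar> \<le> D"
  shows "wsq d a x y \<le> D\<^sup>2 * (\<Sum>i<d. a i)"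
  unfolding wsq_def sum_distrib_left
proof (rule sum_mono)
  fix i assume "i \<in> {..<d}"
  then have "(x i - y i)\<^sup>2 \<le> D\<^sup>2" "0 \<le> a i"
    using assms by (auto simp: abs_le_square_iff[symmetric] intro: order_trans[OF _ abs_ge_self])
  then show "a i * (x i - y i)\<^sup>2 \<le> D\<^sup>2 * a i"
    by (simp add: mult.commute mult_left_mono)
qed

lemma wnorm_sq: "(\<And>i. i < d \<Longrightarrow> 0 \<le> a i) \<Longrightarrow> (wnorm d a (\<lambda>i. x i - y i))\<^sup>2 = wsq d a x y"
  unfolding wnorm_def wsq_def L2_set_def
  by (subst real_sqrt_pow2) (auto intro!: sum_nonneg sum.cong simp: power_mult_distrib)

text \<open>The exact convexity defect of a weighted square, to be set against the defect that
  \<open>curv\<close> permits.\<close>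

lemma wsq_convex_comb:
  "wsq d a x (\<lambda>i. (1 - t) * p i + t * y i)
     = (1 - t) * wsq d a x p + t * wsq d a x y - t * (1 - t) * wsq d a y p"
  unfolding wsq_def sum_distrib_left sum.distrib[symmetric] sum_subtractf[symmetric]
  by (intro sum.cong refl) (simp add: power2_eq_square algebra_simps)

section \<open>Coordinatewise convergence\<close>

lemma tendsto_coordinatewise_fun:
  fixes f :: "'b \<Rightarrow> nat \<Rightarrow> real"
  assumes "\<And>i. ((\<lambda>x. f x i) \<longlongrightarrow> l i) F"
  shows "(f \<longlongrightarrow> l) F"
proof -
  have "limitin (product_topology (\<lambda>i. euclidean) UNIV) f l F"
    using assms by (auto simp: limitin_componentwise)
  then show ?thesis
    by (simp add: euclidean_product_topology)
qed

lemma tendsto_coord: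
  fixes f :: "'b \<Rightarrow> nat \<Rightarrow> real"
  assumes "(f \<longlongrightarrow> l) F"
  shows "((\<lambda>x. f x i) \<longlongrightarrow> l i) F"
proof -
  have "limitin (product_topology (\<lambda>i. euclidean) UNIV) f l F"
    using assms by (simp add: euclidean_product_topology)
  then show ?thesis
    by (auto simp: limitin_componentwise)
qed

text \<open>Two forms of weak convexity are kept side by side: \<open>curv\<close> gives curvature
  along segments, and \<open>subgrad\<close> gives a continuous minorant touching \<phi> at each
  point, which replaces lower semicontinuity. The locale serves both the objective and, with \<phi>
  = 0 and c = 0, the projection onto X.\<close>

locale weakly_convex_ext =
  fixes d :: nat and X :: "(nat \<Rightarrow> real) set" and \<phi> :: "(nat \<Rightarrow> real) \<Rightarrow> real"
    and c :: "nat \<Rightarrow> real" and w :: "(nat \<Rightarrow> real) \<Rightarrow> nat \<Rightarrow> real" and lb D :: real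
  assumes X_Rd: "X \<subseteq> Rd d" and X_ne: "X \<noteq> {}" and X_closed: "closed X" and X_convex: "convex_set X"
    and X_bdd: "\<And>y z i. y \<in> X \<Longrightarrow> z \<in> X \<Longrightarrow> i < d \<Longrightarrow> \<bar>y i - z i\<bar> \<le> D"
    and curv: "\<And>x y t. x \<in> X \<Longrightarrow> y \<in> X \<Longrightarrow> 0 < t \<Longrightarrow> t < 1 \<Longrightarrow>
        \<phi> (\<lambda>i. (1 - t) * x i + t * y i) \<le> (1 - t) * \<phi> x + t * \<phi> y + t * (1 - t) / 2 * wsq d c y x"
    and subgrad: "\<And>x y. x \<in> X \<Longrightarrow> y \<in> X \<Longrightarrow>
        \<phi> x + dot d (w x) (\<lambda>i. y i - x i) - 1 / 2 * wsq d c y x \<le> \<phi> y"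
    and lb: "\<And>y. y \<in> X \<Longrightarrow> lb \<le> \<phi> y"
begin

lemma X_compact: "compact X"
proof -
  obtain z where z: "z \<in> X" using X_ne by auto
  \<comment> \<open>Coordinates from \<open>d\<close> on are pinned to 0, so X lies in a product of
    compact sets.\<close>
  define B where "B i = (if i < d then {z i - D..z i + D} else {0::real})" for i
  have "compactin (product_topology (\<lambda>i::nat. euclidean::real topology) UNIV) (PiE UNIV B)"
    unfolding compactin_PiE by (auto simp: B_def)
  then have "compact (PiE UNIV B)"
    by (simp add: euclidean_product_topology)
  moreover have "X \<subseteq> PiE UNIV B"
  proof
    fix y assume y: "y \<in> X"
    then have "y i \<in> B i" for i
      using X_bdd[OF y z, of i] X_Rd by (auto simp: B_def Rd_def)
    then show "y \<in> PiE UNIV B" by auto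
  qed
  ultimately show ?thesis
    using X_closed by (metis compact_Int_closed inf.absorb_iff2)
qed

section \<open>Existence and quadratic growth of proximal points\<close>

definition obj :: "real \<Rightarrow> (nat \<Rightarrow> real) \<Rightarrow> (nat \<Rightarrow> real) \<Rightarrow> (nat \<Rightarrow> real) \<Rightarrow> real" where
  "obj \<zeta> a x y = \<phi> y + 1 / (2 * \<zeta>) * wsq d a x y"

lemma obj_attains:
  assumes \<zeta>: "0 < \<zeta>" and a: "\<And>i. i < d \<Longrightarrow> 0 \<le> a i"
  obtains p where "p \<in> X" "\<And>y. y \<in> X \<Longrightarrow> obj \<zeta> a x p \<le> obj \<zeta> a x y"
proof -
  define m where "m = Inf (obj \<zeta> a x ` X)"
  have bdd: "bdd_below (obj \<zeta> a x ` X)"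
    using lb \<zeta> wsq_nonneg[OF a]
    by (intro bdd_belowI[of _ lb]) (auto simp: obj_def intro!: add_increasing2)
  have "\<exists>y\<in>X. obj \<zeta> a x y < m + 1 / real (Suc n)" for n
    using cInf_lessD[of "obj \<zeta> a x ` X" "m + 1 / real (Suc n)"] X_ne by (auto simp: m_def)
  then obtain y where y: "\<And>n. y n \<in> X" "\<And>n. obj \<zeta> a x (y n) < m + 1 / real (Suc n)"
    by metis
  from X_compact have "seq_compact X" by (simp add: compact_eq_seq_compact_metric)
  from seq_compactE[OF this] y(1) obtain p r where
    p: "p \<in> X" "strict_mono (r :: nat \<Rightarrow> nat)" "(y \<circ> r) \<longlonglongrightarrow> p" by metis
  have co: "(\<lambda>n. y (r n) i) \<longlonglongrightarrow> p i" for i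
    using tendsto_coord[OF p(3)] by (simp add: o_def)
  \<comment> \<open>\<open>L\<close> replaces \<phi> by its subgradient minorant at the limit point
    p: it is continuous, lies below the objective on X, and agrees with it at p.\<close>
  define L where "L z = \<phi> p + dot d (w p) (\<lambda>i. z i - p i) - 1 / 2 * wsq d c z p + 1 / (2 * \<zeta>) * wsq d a x z" for z
  have "(\<lambda>n. L (y (r n))) \<longlonglongrightarrow> L p"
    unfolding L_def dot_def wsq_def by (intro tendsto_intros co)
  moreover have "(\<lambda>n. m + 1 / real (Suc (r n))) \<longlonglongrightarrow> m + 0"
    using LIMSEQ_subseq_LIMSEQ[OF lim_inverse_n'[THEN LIMSEQ_Suc] p(2)]
    by (intro tendsto_intros) (auto simp: o_def)
  moreover have "L (y (r n)) \<le> m + 1 / real (Suc (r n))" for n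
    using subgrad[OF p(1) y(1)[of "r n"]] y(2)[of "r n"] by (auto simp: L_def obj_def)
  ultimately have "L p \<le> m"
    using LIMSEQ_le[of "\<lambda>n. L (y (r n))" "L p" "\<lambda>n. m + 1 / real (Suc (r n))" "m + 0"] by auto
  moreover have "L p = obj \<zeta> a x p" by (simp add: L_def obj_def dot_def)
  ultimately show ?thesis
    using p(1) cInf_lower[OF _ bdd] that[of p] unfolding m_def by (metis imageI order_trans)
qed

text \<open>Minimality of p against a point of the segment to y leaves, after division by t, the
  growth term times 1 - t; letting t tend to 0 recovers it in full.\<close>

lemma growth:
  assumes p: "p \<in> X" "\<And>y. y \<in> X \<Longrightarrow> obj \<zeta> a x p \<le> obj \<zeta> a x y" and y: "y \<in> X"
  shows "obj \<zeta> a x p + 1 / 2 * wsq d (\<lambda>i. a i / \<zeta> - c i) y p \<le> obj \<zeta> a x y"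
proof -
  have W: "wsq d (\<lambda>i. a i / \<zeta> - c i) y p = 1 / \<zeta> * wsq d a y p - wsq d c y p"
    using wsq_scale[of d "1 / \<zeta>" a y p] by (simp add: wsq_diff)
  have "s * (1 / 2 * wsq d (\<lambda>i. a i / \<zeta> - c i) y p) \<le> obj \<zeta> a x y - obj \<zeta> a x p"
    if s: "0 < s" "s < 1" for s
  proof -
    \<comment> \<open>With s = 1 - t the limit takes the multiplicative form that
      \<open>field_le_mult_one_interval\<close> expects.\<close>
    define t where "t = 1 - s"
    have t: "0 < t" "t < 1" using s by (auto simp: t_def)
    let ?z = "\<lambda>i. (1 - t) * p i + t * y i"
    have "?z \<in> X" using X_convex p(1) y t unfolding convex_set_def by auto
    then have "obj \<zeta> a x p \<le> obj \<zeta> a x ?z" using p by auto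
    also have "\<dots> \<le> (1 - t) * obj \<zeta> a x p + t * obj \<zeta> a x y
        - t * (1 - t) / 2 * wsq d (\<lambda>i. a i / \<zeta> - c i) y p"
      using curv[OF p(1) y t] unfolding obj_def wsq_convex_comb W
      by (simp add: algebra_simps add_divide_distrib diff_divide_distrib)
    finally have "t * (s * (1 / 2 * wsq d (\<lambda>i. a i / \<zeta> - c i) y p))
        \<le> t * (obj \<zeta> a x y - obj \<zeta> a x p)"
      by (simp add: t_def algebra_simps)
    then show ?thesis using t by simp
  qed
  then have "1 / 2 * wsq d (\<lambda>i. a i / \<zeta> - c i) y p \<le> obj \<zeta> a x y - obj \<zeta> a x p"
    by (rule field_le_mult_one_interval)
  then show ?thesis by simp
qed

lemma ext_obj:
  assumes a: "\<And>i. i < d \<Longrightarrow> 0 \<le> a i"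
  shows "ext_fun X \<phi> y + ereal (1 / (2 * \<zeta>) * (wnorm d a (\<lambda>i. x i - y i))\<^sup>2)
    = (if y \<in> X then ereal (obj \<zeta> a x y) else \<infinity>)"
  by (simp add: ext_fun_def wnorm_sq[OF a] obj_def)

context
  fixes \<zeta> :: real and a :: "nat \<Rightarrow> real"
  assumes \<zeta>: "0 < \<zeta>" and a: "\<And>i. i < d \<Longrightarrow> 0 \<le> a i"
begin

lemma ext_obj_context:
  "ext_fun X \<phi> y + ereal (1 / (2 * \<zeta>) * (wnorm d a (\<lambda>i. x i - y i))\<^sup>2)
    = (if y \<in> X then ereal (obj \<zeta> a x y) else \<infinity>)"
  by (rule ext_obj) (rule a)

text \<open>\<open>prox\<close> is an arbitrary choice among minimizers, so it inherits these
  properties once a minimizer exists; infinite values off X force the choice into X.\<close>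

lemma prox_min:
  shows prox_in: "prox d (ext_fun X \<phi>) \<zeta> a x \<in> X" (is "?p \<in> X")
    and prox_le: "y \<in> X \<Longrightarrow> obj \<zeta> a x (prox d (ext_fun X \<phi>) \<zeta> a x) \<le> obj \<zeta> a x y"
proof -
  obtain p0 where p0: "p0 \<in> X" "\<And>y. y \<in> X \<Longrightarrow> obj \<zeta> a x p0 \<le> obj \<zeta> a x y"
    using obj_attains[of \<zeta> a x] \<zeta> a by metis
  let ?f = "\<lambda>y. if y \<in> X then ereal (obj \<zeta> a x y) else \<infinity>"
  have "is_arg_min ?f (\<lambda>y. y \<in> Rd d) p0"
    using p0 X_Rd by (auto simp: is_arg_min_def not_less)
  then have A: "is_arg_min ?f (\<lambda>y. y \<in> Rd d) ?p"
    unfolding prox_def ext_obj_context arg_min_def by (rule someI[where P = "is_arg_min ?f (\<lambda>y. y \<in> Rd d)"])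
  have "\<not> ?f p0 < ?f ?p" using A p0(1) X_Rd unfolding is_arg_min_def by blast
  then show 1: "?p \<in> X" using p0(1) by (auto split: if_splits)
  show "obj \<zeta> a x ?p \<le> obj \<zeta> a x y" if "y \<in> X"
    using A X_Rd that 1 by (force simp: is_arg_min_def not_less)
qed

lemma prox_growth:
  "y \<in> X \<Longrightarrow> obj \<zeta> a x (prox d (ext_fun X \<phi>) \<zeta> a x)
     + 1 / 2 * wsq d (\<lambda>i. a i / \<zeta> - c i) y (prox d (ext_fun X \<phi>) \<zeta> a x) \<le> obj \<zeta> a x y"
  by (rule growth[OF prox_in prox_le])

lemma moreau_env_eq:
  "moreau_env d (ext_fun X \<phi>) \<zeta> a x = ereal (obj \<zeta> a x (prox d (ext_fun X \<phi>) \<zeta> a x))"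
  unfolding moreau_env_def ext_obj_context
proof (rule antisym)
  show "(INF y\<in>Rd d. if y \<in> X then ereal (obj \<zeta> a x y) else \<infinity>)
      \<le> ereal (obj \<zeta> a x (prox d (ext_fun X \<phi>) \<zeta> a x))"
    using prox_in X_Rd by (intro INF_lower2[of "prox d (ext_fun X \<phi>) \<zeta> a x"]) auto
  show "ereal (obj \<zeta> a x (prox d (ext_fun X \<phi>) \<zeta> a x))
      \<le> (INF y\<in>Rd d. if y \<in> X then ereal (obj \<zeta> a x y) else \<infinity>)"
    using prox_le by (intro INF_greatest) auto
qed

end

end

section \<open>Stability of the proximal map and the gradient of the envelope\<close>

context weakly_convex_ext
begin

abbreviation "P \<equiv> prox d (ext_fun X \<phi>)"

lemma X_Rd_zero: "y \<in> X \<Longrightarrow> d \<le> i \<Longrightarrow> y i = 0"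
  using X_Rd by (auto simp: Rd_def)

text \<open>Growth around p for (a, x) is added to minimality of p' for (a', x'), and the values of
  \<phi> cancel. Point and metric vary together because both are random along a run. A bound linear
  in the perturbation suffices for continuity.\<close>

lemma prox_stability:
  assumes \<zeta>: "0 < \<zeta>" and a: "\<And>i. i < d \<Longrightarrow> 0 \<le> a i" and a': "\<And>i. i < d \<Longrightarrow> 0 \<le> a' i"
  shows "wsq d (\<lambda>i. a i / \<zeta> - c i) (P \<zeta> a' x') (P \<zeta> a x)
    \<le> 1 / \<zeta> * (\<Sum>i<d. 2 * D * \<bar>a i * x i - a' i * x' i\<bar>
        + \<bar>a i - a' i\<bar> * (D * (D + 2 * \<bar>P \<zeta> a x i\<bar>)))"
proof -
  define p p' where "p = P \<zeta> a x" and "p' = P \<zeta> a' x'"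
  have pX: "p \<in> X" "p' \<in> X"
    using prox_in[OF \<zeta> a] prox_in[OF \<zeta> a'] by (auto simp: p_def p'_def)
  have 1: "obj \<zeta> a x p + 1 / 2 * wsq d (\<lambda>i. a i / \<zeta> - c i) p' p \<le> obj \<zeta> a x p'"
    unfolding p_def by (rule prox_growth[OF \<zeta> a pX(2)])
  have 2: "obj \<zeta> a' x' p' \<le> obj \<zeta> a' x' p"
    unfolding p'_def by (rule prox_le[OF \<zeta> a' pX(1)])
  \<comment> \<open>The moving point p' enters the right-hand side only through p' - p, which
    \<open>D\<close> bounds, so p can be held fixed while (a', x') tends to (a, x).\<close>
  have "wsq d a x p' - wsq d a' x' p' + wsq d a' x' p - wsq d a x p
      = (\<Sum>i<d. 2 * (a' i * x' i - a i * x i) * (p' i - p i)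
          + (a i - a' i) * ((p' i - p i) * ((p' i - p i) + 2 * p i)))"
    unfolding wsq_def sum.distrib[symmetric] sum_subtractf[symmetric]
    by (intro sum.cong refl) (simp add: power2_eq_square algebra_simps)
  also have "\<dots> \<le> (\<Sum>i<d. 2 * D * \<bar>a i * x i - a' i * x' i\<bar> + \<bar>a i - a' i\<bar> * (D * (D + 2 * \<bar>p i\<bar>)))"
  proof (intro sum_mono add_mono)
    fix i assume "i \<in> {..<d}"
    then have D: "\<bar>p' i - p i\<bar> \<le> D" using X_bdd[OF pX(2,1)] by auto
    then have D0: "0 \<le> D" by linarith
    have "2 * (a' i * x' i - a i * x i) * (p' i - p i) \<le> 2 * (\<bar>a i * x i - a' i * x' i\<bar> * \<bar>p' i - p i\<bar>)"
      using abs_ge_self[of "(a' i * x' i - a i * x i) * (p' i - p i)"]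
      unfolding abs_mult by (simp only: abs_minus_commute[of "a i * x i"] mult.assoc)
    also have "\<dots> \<le> 2 * (\<bar>a i * x i - a' i * x' i\<bar> * D)"
      using D by (intro mult_left_mono) auto
    finally show "2 * (a' i * x' i - a i * x i) * (p' i - p i) \<le> 2 * D * \<bar>a i * x i - a' i * x' i\<bar>"
      by (simp add: mult_ac)
    have "(a i - a' i) * ((p' i - p i) * ((p' i - p i) + 2 * p i))
        \<le> \<bar>a i - a' i\<bar> * (\<bar>p' i - p i\<bar> * \<bar>(p' i - p i) + 2 * p i\<bar>)"
      unfolding abs_mult[symmetric] by (rule abs_ge_self)
    also have "\<dots> \<le> \<bar>a i - a' i\<bar> * (D * (D + 2 * \<bar>p i\<bar>))"
      using D D0 by (intro mult_left_mono mult_mono) auto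
    finally show "(a i - a' i) * ((p' i - p i) * ((p' i - p i) + 2 * p i))
        \<le> \<bar>a i - a' i\<bar> * (D * (D + 2 * \<bar>p i\<bar>))" .
  qed
  finally have 3: "wsq d a x p' - wsq d a' x' p' + wsq d a' x' p - wsq d a x p \<le> \<dots>" .
  have "wsq d (\<lambda>i. a i / \<zeta> - c i) p' p
      \<le> 1 / \<zeta> * (wsq d a x p' - wsq d a' x' p' + wsq d a' x' p - wsq d a x p)"
    using 1 2 by (simp add: obj_def algebra_simps add_divide_distrib diff_divide_distrib)
  also have "\<dots> \<le> 1 / \<zeta> * (\<Sum>i<d. 2 * D * \<bar>a i * x i - a' i * x' i\<bar> + \<bar>a i - a' i\<bar> * (D * (D + 2 * \<bar>p i\<bar>)))"
    using 3 \<zeta> by (intro mult_left_mono) auto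
  finally show ?thesis unfolding p_def p'_def .
qed

text \<open>The general filter serves both joint continuity in metric and point and the limit y to x
  in the gradient proof.\<close>

lemma prox_tendsto:
  assumes \<zeta>: "0 < \<zeta>" and a: "\<And>i. i < d \<Longrightarrow> 0 \<le> a i \<and> c i < a i / \<zeta>"
    and A: "\<And>n i. i < d \<Longrightarrow> ((\<lambda>n. A n i) \<longlongrightarrow> a i) F"
    and Y: "\<And>n i. i < d \<Longrightarrow> ((\<lambda>n. Y n i) \<longlongrightarrow> x i) F"
    and Apos: "\<forall>\<^sub>F n in F. \<forall>i<d. 0 \<le> A n i"
  shows "((\<lambda>n. P \<zeta> (A n) (Y n) i) \<longlongrightarrow> P \<zeta> a x i) F"
proof (cases "i < d")
  case i: True
  define p where "p = P \<zeta> a x"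
  define e where "e = a i / \<zeta> - c i"
  have e: "0 < e" using a[OF i] by (simp add: e_def)
  define B where "B n = 1 / \<zeta> * (\<Sum>i<d. 2 * D * \<bar>a i * x i - A n i * Y n i\<bar>
        + \<bar>a i - A n i\<bar> * (D * (D + 2 * \<bar>p i\<bar>)))" for n
  have "(B \<longlongrightarrow> 1 / \<zeta> * (\<Sum>i<d. 2 * D * \<bar>a i * x i - a i * x i\<bar> + \<bar>a i - a i\<bar> * (D * (D + 2 * \<bar>p i\<bar>)))) F"
    unfolding B_def by (intro tendsto_intros A Y) auto
  then have B0: "((\<lambda>n. B n / e) \<longlongrightarrow> 0) F" by (auto intro: tendsto_divide_zero)
  have le: "\<forall>\<^sub>F n in F. (P \<zeta> (A n) (Y n) i - p i)\<^sup>2 \<le> B n / e"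
    using Apos
  proof eventually_elim
    case (elim n)
    have "e * (P \<zeta> (A n) (Y n) i - p i)\<^sup>2
        \<le> wsq d (\<lambda>i. a i / \<zeta> - c i) (P \<zeta> (A n) (Y n)) p"
      unfolding wsq_def e_def using i a
      by (intro member_le_sum[where f = "\<lambda>i. (a i / \<zeta> - c i) * (P \<zeta> (A n) (Y n) i - p i)\<^sup>2"])
         (auto intro!: mult_nonneg_nonneg simp: less_imp_le)
    also have "\<dots> \<le> B n"
      unfolding B_def p_def using a elim by (intro prox_stability[OF \<zeta>]) auto
    finally show ?case using e by (simp add: field_simps)
  qed
  have "((\<lambda>n. (P \<zeta> (A n) (Y n) i - p i)\<^sup>2) \<longlongrightarrow> 0) F"
    by (rule tendsto_sandwich[OF _ le tendsto_const B0]) auto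
  from tendsto_real_sqrt[OF this] have "((\<lambda>n. P \<zeta> (A n) (Y n) i - p i) \<longlongrightarrow> 0) F"
    by (simp add: tendsto_rabs_zero_iff)
  then show ?thesis unfolding p_def by (rule LIM_zero_cancel)
next
  case False
  have "\<forall>\<^sub>F n in F. P \<zeta> (A n) (Y n) i = P \<zeta> a x i"
    using Apos
  proof eventually_elim
    case (elim n)
    then show ?case
      using prox_in[OF \<zeta>, of "A n"] prox_in[OF \<zeta>, of a] a False X_Rd_zero by (metis not_less)
  qed
  then show ?thesis by (rule tendsto_eventually)
qed

text \<open>Nothing measurable can be read off a choice operator; the proximal map is instead
  continuous on the set \<open>S\<close> of admissible pairs of metric and point.\<close>

lemma measurable_prox:
  assumes \<zeta>: "0 < \<zeta>" and A: "A \<in> borel_measurable N" and Y: "Y \<in> borel_measurable N"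
    and pos: "\<And>\<omega> i. \<omega> \<in> space N \<Longrightarrow> i < d \<Longrightarrow> 0 \<le> A \<omega> i \<and> c i < A \<omega> i / \<zeta>"
  shows "(\<lambda>\<omega>. P \<zeta> (A \<omega>) (Y \<omega>)) \<in> borel_measurable N"
proof -
  define S :: "((nat \<Rightarrow> real) \<times> (nat \<Rightarrow> real)) set"
    where "S = {s. \<forall>i<d. 0 \<le> fst s i \<and> c i < fst s i / \<zeta>}"
  have "continuous_on S (\<lambda>s. P \<zeta> (fst s) (snd s))"
    unfolding continuous_on_def
  proof (intro ballI tendsto_coordinatewise_fun)
    fix s i assume s: "s \<in> S"
    have id: "((\<lambda>s. s) \<longlongrightarrow> s) (at s within S)" by (rule tendsto_ident_at)
    show "((\<lambda>s. P \<zeta> (fst s) (snd s) i) \<longlongrightarrow> P \<zeta> (fst s) (snd s) i) (at s within S)"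
    proof (rule prox_tendsto[OF \<zeta>])
      show "((\<lambda>s. fst s i) \<longlongrightarrow> fst s i) (at s within S)" for i
        by (intro tendsto_coord tendsto_fst id)
      show "((\<lambda>s. snd s i) \<longlongrightarrow> snd s i) (at s within S)" for i
        by (intro tendsto_coord tendsto_snd id)
      show "\<forall>\<^sub>F s in at s within S. \<forall>i<d. 0 \<le> fst s i"
        by (auto simp: eventually_at_filter S_def)
    qed (use s in \<open>auto simp: S_def\<close>)
  qed
  then have 1: "(\<lambda>s. P \<zeta> (fst s) (snd s)) \<in> borel_measurable (restrict_space borel S)"
    by (rule borel_measurable_continuous_on_restrict)
  have 2: "(\<lambda>\<omega>. (A \<omega>, Y \<omega>)) \<in> measurable N (restrict_space borel S)"
    using pos by (intro measurable_restrict_space2 borel_measurable_Pair A Y) (auto simp: S_def)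
  show ?thesis using measurable_compose[OF 2 1] by simp
qed

text \<open>Testing the value at y with the minimizer for x bounds the remainder \<open>R\<close>
  above; testing the value at x with the minimizer for y bounds it below. Thus \<phi> is never
  differentiated, and continuity of the proximal map makes the lower bound of smaller order than
  \<open>n\<close>.\<close>

lemma has_gradient_moreau_env:
  assumes \<zeta>: "0 < \<zeta>" and a: "\<And>i. i < d \<Longrightarrow> 0 \<le> a i \<and> c i < a i / \<zeta>" and x: "x \<in> Rd d"
  shows "has_gradient d (\<lambda>x. real_of_ereal (moreau_env d (ext_fun X \<phi>) \<zeta> a x))
    (\<lambda>i. a i / \<zeta> * (x i - P \<zeta> a x i)) x"
proof -
  have a0: "\<And>i. i < d \<Longrightarrow> 0 \<le> a i" using a by auto
  define p where "p y = P \<zeta> a y" for y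
  define E where "E y = obj \<zeta> a y (p y)" for y
  define g where "g i = a i / \<zeta> * (x i - p x i)" for i
  have pX: "p y \<in> X" for y unfolding p_def by (rule prox_in[OF \<zeta> a0])
  define R where "R y = E y - E x - dot d g (\<lambda>i. y i - x i)" for y
  define n where "n y = L2_set (\<lambda>i. y i - x i) {..<d}" for y
  have n: "\<bar>y i - x i\<bar> \<le> n y" "0 \<le> n y" if "i < d" for y i
    using member_le_L2_set[of "{..<d}" i "\<lambda>i. \<bar>y i - x i\<bar>"] that
    by (auto simp: n_def L2_set_def sum_nonneg)
  have n0: "0 \<le> n y" for y by (simp add: n_def)
  \<comment> \<open>For z = p x the mixed term vanishes; for z = p y it measures the displacement of
    the minimizer.\<close>
  have dist: "1 / (2 * \<zeta>) * wsq d a y z - 1 / (2 * \<zeta>) * wsq d a x z - dot d g (\<lambda>i. y i - x i)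
      = (\<Sum>i<d. a i / (2 * \<zeta>) * (y i - x i)\<^sup>2 + a i / \<zeta> * ((y i - x i) * (p x i - z i)))" for y z
    unfolding wsq_def dot_def g_def sum_distrib_left sum_subtractf[symmetric]
    using \<zeta> by (intro sum.cong refl) (simp add: field_simps power2_eq_square)
  have up: "R y \<le> n y * (\<Sum>i<d. a i / (2 * \<zeta>) * \<bar>y i - x i\<bar>)" for y
  proof -
    have "E y \<le> obj \<zeta> a y (p x)"
      unfolding E_def using prox_le[OF \<zeta> a0 pX[of x], where x = y] by (simp add: p_def)
    then have "R y \<le> (\<Sum>i<d. a i / (2 * \<zeta>) * (y i - x i)\<^sup>2)"
      using dist[of y "p x"] by (simp add: R_def obj_def E_def)
    also have "\<dots> \<le> (\<Sum>i<d. n y * (a i / (2 * \<zeta>) * \<bar>y i - x i\<bar>))"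
    proof (rule sum_mono)
      fix i assume i: "i \<in> {..<d}"
      have "(y i - x i)\<^sup>2 \<le> n y * \<bar>y i - x i\<bar>"
        using mult_right_mono[OF n(1)[of i y], of "\<bar>y i - x i\<bar>"] i by (simp add: power2_eq_square)
      then have "a i / (2 * \<zeta>) * (y i - x i)\<^sup>2 \<le> a i / (2 * \<zeta>) * (n y * \<bar>y i - x i\<bar>)"
        using a0[of i] i \<zeta> by (intro mult_left_mono) auto
      then show "a i / (2 * \<zeta>) * (y i - x i)\<^sup>2 \<le> n y * (a i / (2 * \<zeta>) * \<bar>y i - x i\<bar>)"
        by (simp add: mult_ac)
    qed
    finally show ?thesis by (simp add: sum_distrib_left)
  qed
  have low: "- n y * (\<Sum>i<d. a i / \<zeta> * \<bar>p x i - p y i\<bar>) \<le> R y" for y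
  proof -
    have "(\<Sum>i<d. - n y * (a i / \<zeta> * \<bar>p x i - p y i\<bar>))
        \<le> (\<Sum>i<d. a i / (2 * \<zeta>) * (y i - x i)\<^sup>2 + a i / \<zeta> * ((y i - x i) * (p x i - p y i)))"
    proof (rule sum_mono)
      fix i assume i: "i \<in> {..<d}"
      have "- ((y i - x i) * (p x i - p y i)) \<le> \<bar>y i - x i\<bar> * \<bar>p x i - p y i\<bar>"
        using abs_ge_minus_self[of "(y i - x i) * (p x i - p y i)"] by (simp add: abs_mult)
      also have "\<dots> \<le> n y * \<bar>p x i - p y i\<bar>"
        using n i by (intro mult_right_mono) auto
      finally have "a i / \<zeta> * (- (n y * \<bar>p x i - p y i\<bar>)) \<le> a i / \<zeta> * ((y i - x i) * (p x i - p y i))"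
        using a0[of i] i \<zeta> by (intro mult_left_mono) auto
      moreover have "0 \<le> a i / (2 * \<zeta>) * (y i - x i)\<^sup>2"
        using a0[of i] i \<zeta> by auto
      ultimately show "- n y * (a i / \<zeta> * \<bar>p x i - p y i\<bar>)
          \<le> a i / (2 * \<zeta>) * (y i - x i)\<^sup>2 + a i / \<zeta> * ((y i - x i) * (p x i - p y i))"
        by (simp add: mult_ac)
    qed
    moreover have "E x \<le> obj \<zeta> a x (p y)"
      unfolding E_def using prox_le[OF \<zeta> a0 pX[of y], where x = x] by (simp add: p_def)
    ultimately show ?thesis
      using dist[of y "p y"] by (simp add: R_def obj_def E_def sum_distrib_left)
  qed
  have id: "((\<lambda>y. y) \<longlongrightarrow> x) (at x within Rd d)" by (rule tendsto_ident_at)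
  have "((\<lambda>y. p y i) \<longlongrightarrow> p x i) (at x within Rd d)" for i
    unfolding p_def by (rule prox_tendsto[OF \<zeta> a]) (auto intro: tendsto_coord[OF id] always_eventually simp: a0)
  then have L: "((\<lambda>y. - (\<Sum>i<d. a i / \<zeta> * \<bar>p x i - p y i\<bar>)) \<longlongrightarrow> - (\<Sum>i<d. a i / \<zeta> * \<bar>p x i - p x i\<bar>)) (at x within Rd d)"
    by (intro tendsto_intros)
  have U: "((\<lambda>y. \<Sum>i<d. a i / (2 * \<zeta>) * \<bar>y i - x i\<bar>) \<longlongrightarrow> (\<Sum>i<d. a i / (2 * \<zeta>) * \<bar>x i - x i\<bar>)) (at x within Rd d)"
    by (intro tendsto_intros tendsto_coord[OF id]) (use \<zeta> in auto)
  have "((\<lambda>y. R y / n y) \<longlongrightarrow> 0) (at x within Rd d)"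
  proof (rule tendsto_sandwich)
    show "((\<lambda>y. - (\<Sum>i<d. a i / \<zeta> * \<bar>p x i - p y i\<bar>)) \<longlongrightarrow> 0) (at x within Rd d)"
      using L by simp
    show "((\<lambda>y. \<Sum>i<d. a i / (2 * \<zeta>) * \<bar>y i - x i\<bar>) \<longlongrightarrow> 0) (at x within Rd d)"
      using U by simp
    show "\<forall>\<^sub>F y in at x within Rd d. R y / n y \<le> (\<Sum>i<d. a i / (2 * \<zeta>) * \<bar>y i - x i\<bar>)"
    proof (intro always_eventually allI)
      fix y
      \<comment> \<open>Where \<open>n y = 0\<close> the quotient is 0 by convention, so the
        majorant must be nonnegative.\<close>
      have "0 \<le> (\<Sum>i<d. a i / (2 * \<zeta>) * \<bar>y i - x i\<bar>)"
        using a0 \<zeta> by (intro sum_nonneg) auto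
      then show "R y / n y \<le> (\<Sum>i<d. a i / (2 * \<zeta>) * \<bar>y i - x i\<bar>)"
        using up[of y] n0[of y] by (cases "n y = 0") (auto simp: field_simps)
    qed
    show "\<forall>\<^sub>F y in at x within Rd d. - (\<Sum>i<d. a i / \<zeta> * \<bar>p x i - p y i\<bar>) \<le> R y / n y"
    proof (intro always_eventually allI)
      fix y
      have "0 \<le> (\<Sum>i<d. a i / \<zeta> * \<bar>p x i - p y i\<bar>)"
        using a0 \<zeta> by (intro sum_nonneg) auto
      then show "- (\<Sum>i<d. a i / \<zeta> * \<bar>p x i - p y i\<bar>) \<le> R y / n y"
        using low[of y] n0[of y] by (cases "n y = 0") (auto simp: field_simps)
    qed
  qed
  moreover have "g \<in> Rd d"
    using x X_Rd_zero[OF pX] by (auto simp: g_def Rd_def)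
  moreover have "real_of_ereal (moreau_env d (ext_fun X \<phi>) \<zeta> a y) = E y" for y
    using moreau_env_eq[OF \<zeta>, of a y] a0 by (simp add: E_def p_def)
  ultimately show ?thesis
    unfolding has_gradient_def by (simp add: R_def n_def g_def[abs_def] p_def)
qed

end

text \<open>\<open>gradient\<close> is a definite description, so its evaluation requires
  uniqueness. Rays along the first \<open>d\<close> axes stay in \<open>Rd d\<close> and determine
  every coordinate that can be nonzero.\<close>

lemma has_gradient_unique:
  assumes g: "has_gradient d F g x" and g': "has_gradient d F g' x" and x: "x \<in> Rd d"
  shows "g = g'"
proof (rule ext)
  fix i
  show "g i = g' i"
  proof (cases "i < d")
    case i: True
    define y where "y s j = (if j = i then x j + s else x j)" for s :: real and j
    have yd: "y s j - x j = (if j = i then s else 0)" for s j by (simp add: y_def)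
    have dot: "dot d h (\<lambda>j. y s j - x j) = h i * s" for h s
      unfolding dot_def yd using i by (simp add: if_distrib cong: if_cong)
    have L2: "L2_set (\<lambda>j. y s j - x j) {..<d} = \<bar>s\<bar>" for s
      unfolding yd L2_set_def using i by (simp add: if_distrib[of "\<lambda>u. u\<^sup>2"] cong: if_cong)
    have yl: "filterlim y (at x within Rd d) (at_right 0)"
      unfolding filterlim_at
    proof
      show "\<forall>\<^sub>F s in at_right 0. y s \<in> Rd d \<and> y s \<noteq> x"
        using i x by (auto simp: eventually_at_filter y_def Rd_def fun_eq_iff)
      have "((\<lambda>s. y s j) \<longlongrightarrow> x j) (at_right 0)" for j
        unfolding y_def by (cases "j = i") (auto intro!: tendsto_eq_intros)
      then show "(y \<longlongrightarrow> x) (at_right 0)" by (rule tendsto_coordinatewise_fun)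
    qed
    have T: "((\<lambda>s. (F (y s) - F x - h i * s) / \<bar>s\<bar>) \<longlongrightarrow> 0) (at_right 0)"
      if "has_gradient d F h x" for h
      using that filterlim_compose[OF _ yl, of "\<lambda>y. (F y - F x - dot d h (\<lambda>i. y i - x i)) / L2_set (\<lambda>i. y i - x i) {..<d}" "nhds 0"]
      unfolding has_gradient_def by (simp add: dot L2)
    have "((\<lambda>s. (F (y s) - F x - g' i * s) / \<bar>s\<bar> - (F (y s) - F x - g i * s) / \<bar>s\<bar>) \<longlongrightarrow> 0 - 0) (at_right 0)"
      by (intro tendsto_diff T g g')
    moreover have "\<forall>\<^sub>F s in at_right 0. (F (y s) - F x - g' i * s) / \<bar>s\<bar> - (F (y s) - F x - g i * s) / \<bar>s\<bar> = g i - g' i"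
      by (auto simp: eventually_at_filter field_simps)
    ultimately have "((\<lambda>s. g i - g' i) \<longlongrightarrow> 0) (at_right (0::real))"
      using Lim_transform_eventually by fastforce
    then show ?thesis by (simp add: tendsto_const_iff)
  next
    case False
    then show ?thesis using g g' by (simp add: has_gradient_def Rd_def)
  qed
qed

context weakly_convex_ext
begin

lemma grad_env_eq:
  assumes "0 < \<zeta>" and "\<And>i. i < d \<Longrightarrow> 0 \<le> a i \<and> c i < a i / \<zeta>" and "x \<in> Rd d"
  shows "grad_env d (ext_fun X \<phi>) \<zeta> a x = (\<lambda>i. a i / \<zeta> * (x i - P \<zeta> a x i))"
  unfolding grad_env_def gradient_def
  using has_gradient_moreau_env[OF assms] has_gradient_unique assms(3) by blast

end

section \<open>Pathwise analysis of FEMA\<close>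

lemma indicator_fun_ext: "indicator_fun X = ext_fun X (\<lambda>_. 0)"
  by (simp add: fun_eq_iff indicator_fun_def ext_fun_def)

text \<open>Adaptedness in functional form: a full sample sequence may later be replaced by its
  restriction to the past.\<close>

lemma fema_state_cong:
  "(\<And>s. s < t \<Longrightarrow> xi s = xi' s) \<Longrightarrow>
    fema_state d h G q \<alpha> b \<beta>\<^sub>2 \<beta>\<^sub>3 x\<^sub>0 xi t = fema_state d h G q \<alpha> b \<beta>\<^sub>2 \<beta>\<^sub>3 x\<^sub>0 xi' t"
  by (induction t) (auto simp: Let_def)

text \<open>\<open>al\<close> is a number because the stepsize is constant once the horizon is
  fixed. Of the momentum weights only the range is recorded; their decay enters later, through their
  sum.\<close>

locale fema = weakly_convex_ext d X \<phi> "\<lambda>i. \<rho> * q i" w lb D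
  for d X \<phi> \<rho> q w lb D +
  fixes P\<^sub>\<xi> :: "'a measure" and G :: "(nat \<Rightarrow> real) \<Rightarrow> 'a \<Rightarrow> nat \<Rightarrow> real" and Gm :: real
    and T :: nat and al :: real and b :: "nat \<Rightarrow> real" and \<beta>\<^sub>2 \<beta>\<^sub>3 :: real
    and x\<^sub>0 :: "nat \<Rightarrow> real" and qlo qhi :: real
  assumes \<rho>_pos: "0 < \<rho>" and al_pos: "0 < al"
    and b_range: "\<And>t. t \<le> T \<Longrightarrow> 0 \<le> b t \<and> b t \<le> 1"
    and \<beta>_range: "0 \<le> \<beta>\<^sub>2" "\<beta>\<^sub>2 \<le> 1" "0 \<le> \<beta>\<^sub>3" "\<beta>\<^sub>3 \<le> 1"
    and G_bdd: "\<And>z s i. z \<in> X \<Longrightarrow> s \<in> space P\<^sub>\<xi> \<Longrightarrow> i < d \<Longrightarrow> \<bar>G z s i\<bar> \<le> Gm"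
    and Gm_nonneg: "0 \<le> Gm" and D_nonneg: "0 \<le> D"
    and x\<^sub>0_X: "x\<^sub>0 \<in> X"
    and qlo_pos: "0 < qlo" and q_range: "\<And>i. i < d \<Longrightarrow> qlo \<le> q i \<and> q i \<le> qhi"
    and qhi: "0 \<le> qhi" "sqrt qhi < 2"
begin

text \<open>With zero objective and zero curvature, \<open>prox\<close> is the weighted projection
  onto X.\<close>

sublocale H: weakly_convex_ext d X "\<lambda>_. 0" "\<lambda>_. 0" "\<lambda>_ _. 0" 0 D
  by unfold_locales (use X_Rd X_ne X_closed X_convex X_bdd in \<open>auto simp: wsq_def dot_def\<close>)

abbreviation "h \<equiv> ext_fun X (\<lambda>_. 0)"
abbreviation "\<psi> \<equiv> ext_fun X \<phi>"
definition "\<kappa> = 2 - sqrt qhi"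

definition "A = sqrt (max qhi (Gm\<^sup>2))"

definition "st = fema_state d h G q (\<lambda>_. al) b \<beta>\<^sub>2 \<beta>\<^sub>3 x\<^sub>0"

definition "xs xi t = fst (st xi t)"
definition "ms xi t = fst (snd (st xi t))"
definition "us xi t = fst (snd (snd (st xi t)))"
definition "vs xi t = snd (snd (snd (st xi t)))"

text \<open>\<open>as xi t\<close> is determined before sample t is drawn, whereas the step from x_t
  to x_(t+1) uses \<open>as xi (Suc t)\<close>.\<close>

definition "as xi t = (\<lambda>i. sqrt (vs xi t i))"

lemma st_0: "xs xi 0 = x\<^sub>0" "ms xi 0 = (\<lambda>_. 0)" "us xi 0 = (\<lambda>_. 0)" "vs xi 0 = q"
  by (auto simp: st_def xs_def ms_def us_def vs_def)

lemma st_Suc: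
  "ms xi (Suc t) = (\<lambda>i. b t * ms xi t i + (1 - b t) * G (xs xi t) (xi t) i)"
  "us xi (Suc t) = (\<lambda>i. \<beta>\<^sub>2 * us xi t i + (1 - \<beta>\<^sub>2) * (G (xs xi t) (xi t) i)\<^sup>2)"
  "vs xi (Suc t) = (\<lambda>i. \<beta>\<^sub>3 * vs xi t i + (1 - \<beta>\<^sub>3) * max (vs xi t i) (us xi (Suc t) i))"
  "xs xi (Suc t) = prox d h al (as xi (Suc t)) (\<lambda>i. xs xi t i - al * ms xi (Suc t) i / as xi (Suc t) i)"
  unfolding xs_def ms_def us_def vs_def as_def st_def
  by (simp_all add: Let_def split: prod.splits)

lemma st_cong:
  assumes "\<And>s. s < t \<Longrightarrow> xi s = xi' s"
  shows "xs xi t = xs xi' t" "vs xi t = vs xi' t" "as xi t = as xi' t"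
  unfolding as_def xs_def vs_def st_def using fema_state_cong[OF assms] by (simp_all cong: fema_state_cong)

section \<open>Invariants of the iterates\<close>

lemma convex_comb_bounds:
  fixes r :: real
  assumes "0 \<le> r" "r \<le> 1" "l \<le> x" "x \<le> u" "l \<le> y" "y \<le> u"
  shows "l \<le> r * x + (1 - r) * y" "r * x + (1 - r) * y \<le> u"
proof -
  have "r * l + (1 - r) * l \<le> r * x + (1 - r) * y" "r * x + (1 - r) * y \<le> r * u + (1 - r) * u"
    using assms by (intro add_mono mult_left_mono; simp)+
  then show "l \<le> r * x + (1 - r) * y" "r * x + (1 - r) * y \<le> u" by (simp_all add: algebra_simps)
qed

text \<open>The new value averages the old one with a maximum that is at least as large; the
  telescoping of the metric rests on this.\<close>

lemma vs_mono: "vs xi t i \<le> vs xi (Suc t) i"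
  unfolding st_Suc(3)
  using convex_comb_bounds(1)[of \<beta>\<^sub>3 "vs xi t i" "vs xi t i" "max (vs xi t i) (us xi (Suc t) i)"] \<beta>_range
  by auto

definition "valid xi \<longleftrightarrow> (\<forall>s\<le>T. xi s \<in> space P\<^sub>\<xi>)"

text \<open>One induction carries all bounds: the gradient bound at step t needs x_t in X, and
  returning to X needs nonnegative metric weights.\<close>

lemma state_invariant:
  assumes "\<And>s. s < t \<Longrightarrow> xi s \<in> space P\<^sub>\<xi>" "t \<le> Suc T"
  shows "xs xi t \<in> X \<and> (\<forall>i<d. \<bar>ms xi t i\<bar> \<le> Gm \<and> 0 \<le> us xi t i \<and> us xi t i \<le> Gm\<^sup>2
    \<and> q i \<le> vs xi t i \<and> vs xi t i \<le> max qhi (Gm\<^sup>2))"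
  using assms
proof (induction t)
  case 0
  then show ?case using x\<^sub>0_X Gm_nonneg q_range by (auto simp: st_0 le_max_iff_disj)
next
  case (Suc t)
  then have IH: "xs xi t \<in> X" "\<And>i. i < d \<Longrightarrow> \<bar>ms xi t i\<bar> \<le> Gm \<and> 0 \<le> us xi t i \<and> us xi t i \<le> Gm\<^sup>2
    \<and> q i \<le> vs xi t i \<and> vs xi t i \<le> max qhi (Gm\<^sup>2)" by auto
  have xi: "xi t \<in> space P\<^sub>\<xi>" and t: "t \<le> T" using Suc.prems by auto
  have g: "\<bar>G (xs xi t) (xi t) i\<bar> \<le> Gm" if "i < d" for i using G_bdd IH(1) xi that by auto
  have m: "\<bar>ms xi (Suc t) i\<bar> \<le> Gm" if i: "i < d" for i
    using convex_comb_bounds[of "b t" "-Gm" "ms xi t i" Gm "G (xs xi t) (xi t) i"]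
      b_range[OF t] IH(2)[OF i] g[OF i] unfolding st_Suc(1) by (simp add: abs_le_iff)
  have u: "0 \<le> us xi (Suc t) i" "us xi (Suc t) i \<le> Gm\<^sup>2" if i: "i < d" for i
    using convex_comb_bounds[of \<beta>\<^sub>2 0 "us xi t i" "Gm\<^sup>2" "(G (xs xi t) (xi t) i)\<^sup>2"]
      \<beta>_range IH(2)[OF i] abs_le_square_iff[of "G (xs xi t) (xi t) i" Gm] g[OF i] Gm_nonneg
    unfolding st_Suc(2) by auto
  have v: "vs xi (Suc t) i \<le> max qhi (Gm\<^sup>2)" if i: "i < d" for i
    unfolding st_Suc(3)
    using IH(2)[OF i] u[OF i] \<beta>_range
    by (intro convex_comb_bounds(2)[where l = "vs xi t i"]) (auto simp: max.coboundedI2)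
  have v': "q i \<le> vs xi (Suc t) i" if i: "i < d" for i
    using vs_mono[of xi t i] IH(2)[OF i] by linarith
  have v0: "0 \<le> vs xi (Suc t) i" if i: "i < d" for i
    using v'[OF i] q_range[OF i] qlo_pos by linarith
  have "xs xi (Suc t) \<in> X"
    unfolding st_Suc(4) by (rule H.prox_in[OF al_pos])
      (use v0 in \<open>auto simp: as_def\<close>)
  then show ?case using m u v v' by auto
qed

lemma A_ge: "sqrt qhi \<le> A" "Gm \<le> A" "0 \<le> A"
  using Gm_nonneg qhi by (auto simp: A_def real_le_rsqrt)

lemma as_bounds:
  assumes "\<And>s. s < t \<Longrightarrow> xi s \<in> space P\<^sub>\<xi>" "t \<le> Suc T" and i: "i < d"
  shows "sqrt (q i) \<le> as xi t i" "as xi t i \<le> A" "sqrt qlo \<le> as xi t i" "0 < as xi t i"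
proof -
  have *: "q i \<le> vs xi t i" "vs xi t i \<le> max qhi (Gm\<^sup>2)" "0 < q i" "qlo \<le> q i"
    using state_invariant[OF assms(1,2)] i q_range[OF i] qlo_pos by auto
  then show "sqrt (q i) \<le> as xi t i" "as xi t i \<le> A" by (auto simp: as_def A_def)
  then show "sqrt qlo \<le> as xi t i" using * by (meson order_trans real_sqrt_le_mono)
  then show "0 < as xi t i" using qlo_pos by (meson less_le_trans real_sqrt_gt_zero)
qed

lemma as_mono: "as xi t i \<le> as xi (Suc t) i"
  using vs_mono by (auto simp: as_def)

lemma ms_le_of:
  assumes "\<And>s. s < t \<Longrightarrow> xi s \<in> space P\<^sub>\<xi>" "t \<le> Suc T" "i < d"
  shows "\<bar>ms xi t i\<bar> \<le> Gm"
  using state_invariant[OF assms(1,2)] assms(3) by auto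

lemma xs_X: "(\<And>s. s < t \<Longrightarrow> xi s \<in> space P\<^sub>\<xi>) \<Longrightarrow> t \<le> Suc T \<Longrightarrow> xs xi t \<in> X"
  using state_invariant by auto

lemma \<kappa>_pos: "0 < \<kappa>" using qhi by (simp add: \<kappa>_def)

text \<open>Of the two factors in q = sqrt q * sqrt q, one is absorbed by \<open>a\<close> and the
  other by \<open>sqrt qhi\<close>. The loss is thus proportional to the metric, and one \<kappa>
  works however far the metric grows.\<close>

lemma curvature_gap:
  assumes "sqrt (q i) \<le> a" "i < d"
  shows "\<kappa> * a \<le> 2 * a - q i"
proof -
  have q: "0 < q i" "q i \<le> qhi" using q_range[OF assms(2)] qlo_pos by auto
  then have "q i = sqrt (q i) * sqrt (q i)" by simp
  also have "\<dots> \<le> sqrt qhi * a" using q assms by (intro mult_mono) auto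
  finally show ?thesis by (simp add: \<kappa>_def algebra_simps)
qed

section \<open>Curvature of the envelope objective\<close>

abbreviation "\<zeta> \<equiv> 1 / (2 * \<rho>)"

lemma \<zeta>_pos: "0 < \<zeta>" using \<rho>_pos by simp

lemma obj_\<zeta>: "obj \<zeta> a x y = \<phi> y + \<rho> * wsq d a x y"
  using \<rho>_pos by (simp add: obj_def)

lemma admissible:
  assumes "sqrt (q i) \<le> a i" "i < d"
  shows "0 \<le> a i \<and> \<rho> * q i < a i / \<zeta>"
proof -
  have "0 < sqrt (q i)" using q_range[OF assms(2)] qlo_pos by auto
  then have a: "0 < a i" using assms by linarith
  have "0 < \<kappa> * a i" using a \<kappa>_pos by simp
  then have "0 < 2 * a i - q i" using curvature_gap[OF assms] by linarith
  then have "0 < \<rho> * (2 * a i - q i)" using \<rho>_pos by simp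
  then show ?thesis using a by (simp add: algebra_simps)
qed

lemma envelope_growth:
  assumes a: "\<And>i. i < d \<Longrightarrow> sqrt (q i) \<le> a i" and y: "y \<in> X"
  shows "obj \<zeta> a x (P \<zeta> a x) + \<rho> * \<kappa> / 2 * wsq d a y (P \<zeta> a x) \<le> obj \<zeta> a x y"
proof -
  have a0: "\<And>i. i < d \<Longrightarrow> 0 \<le> a i" using admissible a by blast
  have "\<rho> * \<kappa> / 2 * wsq d a y (P \<zeta> a x) = 1 / 2 * (\<rho> * wsq d (\<lambda>i. \<kappa> * a i) y (P \<zeta> a x))"
    unfolding wsq_scale by simp
  also have "\<dots> \<le> 1 / 2 * (\<rho> * wsq d (\<lambda>i. 2 * a i - q i) y (P \<zeta> a x))"
    using \<rho>_pos by (intro mult_left_mono wsq_mono curvature_gap a) auto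
  finally have "\<rho> * \<kappa> / 2 * wsq d a y (P \<zeta> a x) \<le> \<dots>" .
  moreover have "\<rho> * wsq d (\<lambda>i. 2 * a i - q i) y (P \<zeta> a x) = wsq d (\<lambda>i. a i / \<zeta> - \<rho> * q i) y (P \<zeta> a x)"
    unfolding wsq_scale[symmetric] by (simp add: algebra_simps)
  moreover have "obj \<zeta> a x (P \<zeta> a x) + 1 / 2 * wsq d (\<lambda>i. a i / \<zeta> - \<rho> * q i) y (P \<zeta> a x) \<le> obj \<zeta> a x y"
    by (rule prox_growth[OF \<zeta>_pos a0 y])
  ultimately show ?thesis by simp
qed

text \<open>The subgradient inequality at x, tested at p, is added to the growth inequality at p,
  tested at x. The values of \<phi> cancel, and the quadratic terms combine to \<rho>(2a - q), which
  \<open>curvature_gap\<close> bounds below.\<close>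

lemma subgrad_angle:
  assumes a: "\<And>i. i < d \<Longrightarrow> sqrt (q i) \<le> a i" and x: "x \<in> X"
  shows "dot d (w x) (\<lambda>i. P \<zeta> a x i - x i) \<le> - (\<rho> * \<kappa> * wsq d a x (P \<zeta> a x))"
proof -
  define p where "p = P \<zeta> a x"
  have a0: "\<And>i. i < d \<Longrightarrow> 0 \<le> a i" using admissible a by blast
  have p: "p \<in> X" unfolding p_def by (rule prox_in[OF \<zeta>_pos a0])
  have "\<phi> x + dot d (w x) (\<lambda>i. p i - x i) - 1 / 2 * wsq d (\<lambda>i. \<rho> * q i) p x \<le> \<phi> p"
    by (rule subgrad[OF x p])
  moreover have "obj \<zeta> a x p + 1 / 2 * wsq d (\<lambda>i. a i / \<zeta> - \<rho> * q i) x p \<le> obj \<zeta> a x x"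
    unfolding p_def by (rule prox_growth[OF \<zeta>_pos a0 x])
  moreover have "wsq d (\<lambda>i. a i / \<zeta> - \<rho> * q i) x p = 2 * \<rho> * wsq d a x p - \<rho> * wsq d q x p"
    unfolding wsq_scale[symmetric] wsq_diff[symmetric] by (simp add: algebra_simps)
  moreover have "wsq d (\<lambda>i. \<rho> * q i) p x = \<rho> * wsq d q x p"
    unfolding wsq_scale by (simp add: wsq_commute)
  ultimately have "dot d (w x) (\<lambda>i. p i - x i) \<le> - (\<rho> * (2 * wsq d a x p - wsq d q x p))"
    unfolding obj_\<zeta> by (simp add: algebra_simps)
  also have "\<dots> = - (\<rho> * wsq d (\<lambda>i. 2 * a i - q i) x p)"
    unfolding wsq_diff wsq_scale by simp
  also have "- (\<rho> * wsq d (\<lambda>i. 2 * a i - q i) x p) \<le> - (\<rho> * wsq d (\<lambda>i. \<kappa> * a i) x p)"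
    using \<rho>_pos by (intro le_imp_neg_le mult_left_mono wsq_mono curvature_gap a) auto
  finally show ?thesis unfolding p_def wsq_scale by (simp add: mult.assoc)
qed

text \<open>
  The proximal point \<open>pt\<close> is taken in the metric of the previous step, so that it does not
  depend on the current sample; \<open>pn\<close> is the one entering the gradient of the envelope.
\<close>

definition "pt xi t = P \<zeta> (as xi t) (xs xi t)"
definition "pn xi t = P \<zeta> (as xi (Suc t)) (xs xi t)"
text \<open>The raw sample gradient appears instead of the momentum: its partner vector depends only
  on earlier samples, so averaging over the current sample produces the subgradient.\<close>

definition "ip xi t = (\<Sum>i<d. G (xs xi t) (xi t) i * (pt xi t i - xs xi t i))"
definition "gap xi t = wsq d (as xi t) (xs xi t) (pt xi t)"
definition "env xi t = obj \<zeta> (as xi t) (xs xi t) (pt xi t)"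
text \<open>By \<open>grad_env_eq\<close>, the squared Euclidean norm of the envelope gradient in
  the metric of step t.\<close>

definition "gsq xi t = (\<Sum>i<d. (as xi (Suc t) i / \<zeta> * (xs xi t i - pn xi t i))\<^sup>2)"
definition "incr xi t = (\<Sum>i<d. as xi (Suc t) i - as xi t i)"

section \<open>One-step estimates on a fixed sample path\<close>

context
  fixes xi t
  assumes xi: "\<And>s. s < Suc t \<Longrightarrow> xi s \<in> space P\<^sub>\<xi>" and t: "t \<le> T"
begin

lemma xi': "\<And>s. s < t \<Longrightarrow> xi s \<in> space P\<^sub>\<xi>" using xi by auto

lemma x_in: "xs xi t \<in> X" using xs_X[of t xi] xi' t by auto
lemma as_q: "i < d \<Longrightarrow> sqrt (q i) \<le> as xi t i" using as_bounds(1)[of t xi] xi' t by auto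
lemma as_q': "i < d \<Longrightarrow> sqrt (q i) \<le> as xi (Suc t) i" using as_bounds(1)[of "Suc t" xi] xi t by auto
lemma as_pos: "i < d \<Longrightarrow> 0 \<le> as xi t i" using admissible as_q by blast
lemma as_pos': "i < d \<Longrightarrow> 0 \<le> as xi (Suc t) i" using admissible as_q' by blast
lemma pt_in: "pt xi t \<in> X" unfolding pt_def by (rule prox_in[OF \<zeta>_pos as_pos])
lemma pn_in: "pn xi t \<in> X" unfolding pn_def by (rule prox_in[OF \<zeta>_pos as_pos'])

text \<open>Growth of the projection objective shows that projecting does not increase the weighted
  distance to y; the distance from the unprojected point to its projection is discarded.\<close>

lemma prox_step:
  assumes y: "y \<in> X"
  shows "wsq d (as xi (Suc t)) (xs xi (Suc t)) y \<le> wsq d (as xi (Suc t)) (xs xi t) y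
    + 2 * al * (\<Sum>i<d. ms xi (Suc t) i * (y i - xs xi t i))
    + al\<^sup>2 * (\<Sum>i<d. (ms xi (Suc t) i)\<^sup>2 / as xi (Suc t) i)"
proof -
  define a where "a = as xi (Suc t)"
  define m where "m = ms xi (Suc t)"
  define x where "x = xs xi t"
  have apos: "0 < a i" if "i < d" for i
    using as_bounds(4)[of "Suc t" xi i] xi t that by (auto simp: a_def)
  define z where "z i = x i - al * m i / a i" for i
  define x' where "x' = prox d h al a z"
  have x': "xs xi (Suc t) = x'"
    unfolding st_Suc(4) x'_def z_def[abs_def] a_def m_def x_def ..
  have "H.obj al a z x' + 1 / 2 * wsq d (\<lambda>i. a i / al - 0) y x' \<le> H.obj al a z y"
    unfolding x'_def by (rule H.prox_growth[OF al_pos as_pos'[folded a_def] y])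
  moreover have "wsq d (\<lambda>i. a i / al - 0) y x' = 1 / al * wsq d a x' y"
    using wsq_scale[of d "1 / al" a y x'] by (simp add: wsq_commute)
  moreover have "0 \<le> wsq d a z x'" using apos by (intro wsq_nonneg) (auto intro: less_imp_le)
  ultimately have "1 / (2 * al) * (wsq d a z x' + wsq d a x' y) \<le> 1 / (2 * al) * wsq d a z y"
    "0 \<le> wsq d a z x'"
    unfolding H.obj_def distrib_left by simp_all
  then have "wsq d a x' y \<le> wsq d a z y"
    using al_pos by (simp add: divide_le_cancel)
  \<comment> \<open>Dividing the momentum by a cancels the weight a, so the cross term is an
    unweighted inner product, as in the subgradient inequality.\<close>
  also have "\<dots> = wsq d a x y + 2 * al * (\<Sum>i<d. m i * (y i - x i)) + al\<^sup>2 * (\<Sum>i<d. (m i)\<^sup>2 / a i)"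
    unfolding wsq_def sum_distrib_left sum.distrib[symmetric]
  proof (intro sum.cong refl)
    fix i assume "i \<in> {..<d}"
    then show "a i * (z i - y i)\<^sup>2 = a i * (x i - y i)\<^sup>2 + 2 * al * (m i * (y i - x i)) + al\<^sup>2 * ((m i)\<^sup>2 / a i)"
      using apos[of i] unfolding z_def by (simp add: field_simps power2_eq_square)
  qed
  finally show ?thesis unfolding x' by (simp add: a_def m_def x_def)
qed

text \<open>The update gives m_t - g_t = b_t (m_(t-1) - g_t), with coordinates at most 2
  \<open>Gm\<close> b_t in size; boundedness of the past momentum avoids unrolling the
  recursion.\<close>

lemma momentum_error:
  "(\<Sum>i<d. ms xi (Suc t) i * (pt xi t i - xs xi t i)) \<le> ip xi t + 2 * Gm * D * d * b t"
proof -
  have "(\<Sum>i<d. ms xi (Suc t) i * (pt xi t i - xs xi t i))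
      = ip xi t + (\<Sum>i<d. b t * (ms xi t i - G (xs xi t) (xi t) i) * (pt xi t i - xs xi t i))" (is "_ = _ + ?e")
    unfolding ip_def st_Suc(1) sum.distrib[symmetric] by (intro sum.cong refl) (simp add: algebra_simps)
  moreover have "?e \<le> (\<Sum>i<d. b t * (2 * Gm) * D)"
  proof (rule sum_mono)
    fix i assume i: "i \<in> {..<d}"
    have 1: "\<bar>ms xi t i - G (xs xi t) (xi t) i\<bar> \<le> 2 * Gm"
      using ms_le_of[of t xi i] xi' t i G_bdd[OF x_in xi[of t], of i]
      by (auto intro!: order_trans[OF abs_triangle_ineq4])
    have 2: "\<bar>pt xi t i - xs xi t i\<bar> \<le> D" using X_bdd[OF pt_in x_in] i by auto
    have "b t * (ms xi t i - G (xs xi t) (xi t) i) * (pt xi t i - xs xi t i)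
        \<le> \<bar>b t\<bar> * \<bar>ms xi t i - G (xs xi t) (xi t) i\<bar> * \<bar>pt xi t i - xs xi t i\<bar>"
      unfolding abs_mult[symmetric] by (rule abs_ge_self)
    also have "\<dots> \<le> b t * (2 * Gm) * D"
      using 1 2 b_range[OF t] Gm_nonneg D_nonneg by (intro mult_mono) auto
    finally show "b t * (ms xi t i - G (xs xi t) (xi t) i) * (pt xi t i - xs xi t i) \<le> b t * (2 * Gm) * D" .
  qed
  ultimately show ?thesis by (simp add: algebra_simps)
qed

lemma metric_change:
  assumes "y \<in> X" "z \<in> X"
  shows "wsq d (as xi (Suc t)) y z \<le> wsq d (as xi t) y z + D\<^sup>2 * incr xi t"
proof -
  have "wsq d (\<lambda>i. as xi (Suc t) i - as xi t i) y z \<le> D\<^sup>2 * incr xi t"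
    unfolding incr_def using as_mono X_bdd[OF assms] by (intro wsq_le_sum) auto
  then show ?thesis unfolding wsq_diff by simp
qed

text \<open>\<open>pt xi t\<close> is used as a competitor in the next envelope, whose metric is
  exactly that of the projection at step t, so \<open>prox_step\<close> applies directly. Only the
  distance from x_t is converted back to the previous metric.\<close>

lemma env_descent:
  "env xi (Suc t) \<le> env xi t + \<rho> * D\<^sup>2 * incr xi t
    + 2 * \<rho> * al * (ip xi t + 2 * Gm * D * d * b t) + \<rho> * al\<^sup>2 * d * Gm\<^sup>2 / sqrt qlo"
proof -
  let ?a = "as xi (Suc t)"
  have "env xi (Suc t) \<le> obj \<zeta> ?a (xs xi (Suc t)) (pt xi t)"
    unfolding env_def pt_def[of xi "Suc t"] by (rule prox_le[OF \<zeta>_pos as_pos' pt_in])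
  also have "\<dots> = \<phi> (pt xi t) + \<rho> * wsq d ?a (xs xi (Suc t)) (pt xi t)" by (rule obj_\<zeta>)
  finally have 1: "env xi (Suc t) \<le> \<dots>" .
  have "(\<Sum>i<d. (ms xi (Suc t) i)\<^sup>2 / ?a i) \<le> (\<Sum>i<d. Gm\<^sup>2 / sqrt qlo)"
  proof (rule sum_mono)
    fix i assume i: "i \<in> {..<d}"
    have "(ms xi (Suc t) i)\<^sup>2 \<le> Gm\<^sup>2"
      using ms_le_of[of "Suc t" xi i] xi t i Gm_nonneg by (auto simp: abs_le_square_iff[symmetric])
    then show "(ms xi (Suc t) i)\<^sup>2 / ?a i \<le> Gm\<^sup>2 / sqrt qlo"
      using as_bounds[of "Suc t" xi i] xi t i qlo_pos by (intro frac_le) auto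
  qed
  then have 2: "al\<^sup>2 * (\<Sum>i<d. (ms xi (Suc t) i)\<^sup>2 / ?a i) \<le> al\<^sup>2 * (d * (Gm\<^sup>2 / sqrt qlo))"
    by (intro mult_left_mono) auto
  have 3: "2 * al * (\<Sum>i<d. ms xi (Suc t) i * (pt xi t i - xs xi t i))
      \<le> 2 * al * (ip xi t + 2 * Gm * D * d * b t)"
    using momentum_error al_pos by (intro mult_left_mono) auto
  have "wsq d ?a (xs xi (Suc t)) (pt xi t) \<le> gap xi t + D\<^sup>2 * incr xi t
      + 2 * al * (ip xi t + 2 * Gm * D * d * b t) + al\<^sup>2 * (d * (Gm\<^sup>2 / sqrt qlo))"
    using prox_step[OF pt_in] metric_change[OF x_in pt_in] 2 3 unfolding gap_def by linarith
  then have "\<rho> * wsq d ?a (xs xi (Suc t)) (pt xi t) \<le> \<rho> * (gap xi t + D\<^sup>2 * incr xi t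
      + 2 * al * (ip xi t + 2 * Gm * D * d * b t) + al\<^sup>2 * (d * (Gm\<^sup>2 / sqrt qlo)))"
    using \<rho>_pos by (intro mult_left_mono) auto
  moreover have "env xi t = \<phi> (pt xi t) + \<rho> * gap xi t" by (simp add: env_def obj_\<zeta> gap_def)
  ultimately show ?thesis using 1 by (simp add: algebra_simps)
qed

text \<open>\<open>pn\<close> and \<open>pt\<close> minimize objectives in ordered metrics. Passing
  from the new objective at \<open>pt\<close> through the old one at \<open>pt\<close> and
  \<open>pn\<close> back to the new one at \<open>pn\<close> costs at most \<rho> \<open>D^2\<close>
  times \<open>incr\<close>; growth turns this into closeness of the two points.\<close>

lemma gsq_le:
  "gsq xi t \<le> 8 * \<rho>\<^sup>2 * A\<^sup>2 / sqrt qlo * (gap xi t + 2 * D\<^sup>2 / \<kappa> * incr xi t)"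
proof -
  let ?a = "as xi (Suc t)"
  define l where "l = sqrt qlo"
  have l: "0 < l" using qlo_pos by (simp add: l_def)
  have A0: "0 \<le> A" by (rule A_ge)
  have "obj \<zeta> ?a (xs xi t) (pn xi t) + \<rho> * \<kappa> / 2 * wsq d ?a (pt xi t) (pn xi t) \<le> obj \<zeta> ?a (xs xi t) (pt xi t)"
    unfolding pn_def by (rule envelope_growth[OF as_q' pt_in])
  moreover have "obj \<zeta> (as xi t) (xs xi t) (pt xi t) \<le> obj \<zeta> (as xi t) (xs xi t) (pn xi t)"
    unfolding pt_def by (rule prox_le[OF \<zeta>_pos as_pos pn_in])
  moreover have "\<rho> * wsq d (as xi t) (xs xi t) (pn xi t) \<le> \<rho> * wsq d ?a (xs xi t) (pn xi t)"
    using as_mono \<rho>_pos by (intro mult_left_mono wsq_mono) auto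
  moreover have "\<rho> * wsq d ?a (xs xi t) (pt xi t) \<le> \<rho> * (wsq d (as xi t) (xs xi t) (pt xi t) + D\<^sup>2 * incr xi t)"
    using metric_change[OF x_in pt_in] \<rho>_pos by (intro mult_left_mono) auto
  ultimately have "\<rho> * \<kappa> / 2 * wsq d ?a (pt xi t) (pn xi t) \<le> \<rho> * (D\<^sup>2 * incr xi t)"
    unfolding obj_\<zeta> distrib_left by linarith
  then have "\<rho> * (\<kappa> * wsq d ?a (pt xi t) (pn xi t)) \<le> \<rho> * (2 * D\<^sup>2 * incr xi t)"
    by (simp add: algebra_simps)
  then have pp: "wsq d ?a (pt xi t) (pn xi t) \<le> 2 * D\<^sup>2 / \<kappa> * incr xi t"
    using mult_left_le_imp_le[OF _ \<rho>_pos] \<kappa>_pos by (simp add: pos_le_divide_eq mult.commute)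
  \<comment> \<open>In the factor, 4\<rho>^2 is the square of 1/\<zeta>, 2 comes from splitting the
    square of u + v, \<open>A^2\<close> bounds the squared weight, and 1/l converts back from
    Euclidean to weighted squares.\<close>
  have "gsq xi t \<le> (\<Sum>i<d. 8 * \<rho>\<^sup>2 * A\<^sup>2 / l * (as xi t i * (xs xi t i - pt xi t i)\<^sup>2 + ?a i * (pt xi t i - pn xi t i)\<^sup>2))"
    unfolding gsq_def
  proof (rule sum_mono)
    fix i assume i: "i \<in> {..<d}"
    define u v where "u = xs xi t i - pt xi t i" and "v = pt xi t i - pn xi t i"
    have a: "l \<le> as xi t i" "l \<le> ?a i" "?a i \<le> A" "0 \<le> ?a i"
      using as_bounds[of t xi i] as_bounds[of "Suc t" xi i] xi xi' t i by (auto simp: l_def intro: less_imp_le)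
    have "(xs xi t i - pn xi t i)\<^sup>2 = (u + v)\<^sup>2" by (simp add: u_def v_def)
    also have "\<dots> \<le> 2 * (u\<^sup>2 + v\<^sup>2)"
      using sum_squares_bound[of u v] by (simp add: power2_sum)
    finally have 0: "(xs xi t i - pn xi t i)\<^sup>2 \<le> 2 * (u\<^sup>2 + v\<^sup>2)" .
    have 3: "u\<^sup>2 + v\<^sup>2 \<le> 1 / l * (as xi t i * u\<^sup>2 + ?a i * v\<^sup>2)"
      using mult_right_mono[OF a(1), of "u\<^sup>2"] mult_right_mono[OF a(2), of "v\<^sup>2"] l by (simp add: field_simps)
    have 1: "(xs xi t i - pn xi t i)\<^sup>2 \<le> 2 * (1 / l * (as xi t i * u\<^sup>2 + ?a i * v\<^sup>2))"
      by (rule order_trans[OF 0 mult_left_mono[OF 3]]) simp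
    have 2: "(?a i)\<^sup>2 \<le> A\<^sup>2" using a by (intro power_mono) auto
    have "(?a i / \<zeta> * (xs xi t i - pn xi t i))\<^sup>2 = 4 * \<rho>\<^sup>2 * ((?a i)\<^sup>2 * (xs xi t i - pn xi t i)\<^sup>2)"
      by (simp add: power_mult_distrib)
    also have "\<dots> \<le> 4 * \<rho>\<^sup>2 * (A\<^sup>2 * (2 * (1 / l * (as xi t i * u\<^sup>2 + ?a i * v\<^sup>2))))"
      using 1 2 by (intro mult_left_mono mult_mono) auto
    also have "\<dots> = 8 * \<rho>\<^sup>2 * A\<^sup>2 / l * (as xi t i * u\<^sup>2 + ?a i * v\<^sup>2)" by (simp add: field_simps)
    finally show "(?a i / \<zeta> * (xs xi t i - pn xi t i))\<^sup>2
        \<le> 8 * \<rho>\<^sup>2 * A\<^sup>2 / l * (as xi t i * (xs xi t i - pt xi t i)\<^sup>2 + ?a i * (pt xi t i - pn xi t i)\<^sup>2)"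
      unfolding u_def v_def .
  qed
  also have "\<dots> = 8 * \<rho>\<^sup>2 * A\<^sup>2 / l * (gap xi t + wsq d ?a (pt xi t) (pn xi t))"
    unfolding gap_def wsq_def sum.distrib[symmetric] sum_distrib_left ..
  also have "\<dots> \<le> 8 * \<rho>\<^sup>2 * A\<^sup>2 / l * (gap xi t + 2 * D\<^sup>2 / \<kappa> * incr xi t)"
    using pp l by (intro mult_left_mono) auto
  finally show ?thesis unfolding l_def .
qed

text \<open>A crude bound, for integrability.\<close>

lemma ip_bound: "\<bar>ip xi t\<bar> \<le> d * (Gm * D)"
  unfolding ip_def
proof (rule order_trans[OF sum_abs])
  have "(\<Sum>i<d. \<bar>G (xs xi t) (xi t) i * (pt xi t i - xs xi t i)\<bar>) \<le> (\<Sum>i<d. Gm * D)"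
    unfolding abs_mult using G_bdd[OF x_in xi[of t]] X_bdd[OF pt_in x_in] Gm_nonneg
    by (intro sum_mono mult_mono) auto
  then show "(\<Sum>i<d. \<bar>G (xs xi t) (xi t) i * (pt xi t i - xs xi t i)\<bar>) \<le> d * (Gm * D)" by simp
qed

lemma gap_bound: "0 \<le> gap xi t" "gap xi t \<le> D\<^sup>2 * (d * A)"
proof -
  show "0 \<le> gap xi t" unfolding gap_def by (rule wsq_nonneg[OF as_pos])
  have "gap xi t \<le> D\<^sup>2 * (\<Sum>i<d. as xi t i)"
    unfolding gap_def using as_pos X_bdd[OF x_in pt_in] by (intro wsq_le_sum) auto
  also have "\<dots> \<le> D\<^sup>2 * (\<Sum>i<d. A)"
    using as_bounds(2)[of t xi] xi' t by (intro mult_left_mono sum_mono) auto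
  finally show "gap xi t \<le> D\<^sup>2 * (d * A)" by simp
qed

lemma incr_nonneg: "0 \<le> incr xi t"
  unfolding incr_def using as_mono by (intro sum_nonneg) auto

lemma gsq_nonneg: "0 \<le> gsq xi t" unfolding gsq_def by (intro sum_nonneg) auto

end

section \<open>Summation along a sample path\<close>

lemma sum_incr:
  assumes "valid xi"
  shows "(\<Sum>t\<le>T. incr xi t) \<le> d * A"
proof -
  have "(\<Sum>t\<le>T. as xi (Suc t) i - as xi t i) = as xi (Suc T) i - as xi 0 i" for i
    using sum_lessThan_telescope[of "\<lambda>t. as xi t i" "Suc T"] by (simp only: lessThan_Suc_atMost)
  then have "(\<Sum>t\<le>T. incr xi t) = (\<Sum>i<d. as xi (Suc T) i - as xi 0 i)"
    unfolding incr_def by (subst sum.swap) simp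
  also have "\<dots> \<le> (\<Sum>i<d. A)"
  proof (rule sum_mono)
    fix i assume "i \<in> {..<d}"
    then show "as xi (Suc T) i - as xi 0 i \<le> A"
      using as_bounds[of "Suc T" xi i] as_bounds[of 0 xi i] assms by (auto simp: valid_def)
  qed
  finally show ?thesis by simp
qed

lemma incr_bound:
  assumes "valid xi" "t \<le> T" shows "incr xi t \<le> d * A"
proof -
  have "incr xi t \<le> (\<Sum>t\<le>T. incr xi t)"
    using assms by (intro member_le_sum incr_nonneg) (auto simp: valid_def)
  then show ?thesis using sum_incr[OF assms(1)] by simp
qed

text \<open>The final envelope is bounded below by \<open>lb\<close> and the initial one is
  deterministic, so no expectation of \<open>env\<close> is ever taken.\<close>

lemma sum_ip:
  assumes xi: "valid xi"
  shows "- (2 * \<rho> * al * (\<Sum>t\<le>T. ip xi t)) \<le> env xi 0 - lb + d * (\<rho> * D\<^sup>2 * A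
    + 4 * \<rho> * al * Gm * D * (\<Sum>t\<le>T. b t) + (T + 1) * (\<rho> * al\<^sup>2 * Gm\<^sup>2 / sqrt qlo))"
proof -
  have s: "xi s \<in> space P\<^sub>\<xi>" if "s < Suc T" for s using xi that by (auto simp: valid_def)
  have "env xi (Suc T) - env xi 0 = (\<Sum>t\<le>T. env xi (Suc t) - env xi t)"
    by (simp add: lessThan_Suc_atMost[symmetric] sum_lessThan_telescope)
  also have "\<dots> \<le> (\<Sum>t\<le>T. \<rho> * D\<^sup>2 * incr xi t
    + 2 * \<rho> * al * (ip xi t + 2 * Gm * D * d * b t) + \<rho> * al\<^sup>2 * d * Gm\<^sup>2 / sqrt qlo)"
    using env_descent[of _ xi] s by (intro sum_mono) (fastforce simp: algebra_simps)
  also have "\<dots> = (\<Sum>t\<le>T. \<rho> * D\<^sup>2 * incr xi t) + (\<Sum>t\<le>T. 2 * \<rho> * al * ip xi t)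
    + (\<Sum>t\<le>T. 4 * \<rho> * al * Gm * D * d * b t) + (\<Sum>t\<le>T. d * (\<rho> * al\<^sup>2 * Gm\<^sup>2 / sqrt qlo))"
    unfolding sum.distrib[symmetric] by (intro sum.cong refl) (simp add: algebra_simps)
  also have "\<dots> = \<rho> * D\<^sup>2 * (\<Sum>t\<le>T. incr xi t) + 2 * \<rho> * al * (\<Sum>t\<le>T. ip xi t)
    + d * (4 * \<rho> * al * Gm * D * (\<Sum>t\<le>T. b t) + (T + 1) * (\<rho> * al\<^sup>2 * Gm\<^sup>2 / sqrt qlo))"
    unfolding sum_distrib_left[symmetric] by (simp add: algebra_simps)
  finally have 1: "env xi (Suc T) - env xi 0 \<le> \<dots>" .
  have "\<rho> * D\<^sup>2 * (\<Sum>t\<le>T. incr xi t) \<le> \<rho> * D\<^sup>2 * (d * A)"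
    using sum_incr[OF xi] \<rho>_pos by (intro mult_left_mono) auto
  with 1 have "env xi (Suc T) - env xi 0 \<le> \<rho> * D\<^sup>2 * (d * A) + 2 * \<rho> * al * (\<Sum>t\<le>T. ip xi t)
    + d * (4 * \<rho> * al * Gm * D * (\<Sum>t\<le>T. b t) + (T + 1) * (\<rho> * al\<^sup>2 * Gm\<^sup>2 / sqrt qlo))" by linarith
  moreover have "lb \<le> env xi (Suc T)"
  proof -
    have a: "0 \<le> as xi (Suc T) i" if "i < d" for i
      using as_bounds(4)[of "Suc T" xi i] s that by (auto intro: less_imp_le)
    have "lb \<le> \<phi> (pt xi (Suc T))"
      unfolding pt_def by (intro lb prox_in[OF \<zeta>_pos] a)
    then show ?thesis
      unfolding env_def obj_\<zeta> using wsq_nonneg[of d "as xi (Suc T)", OF a] \<rho>_pos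
      by (intro add_increasing2) auto
  qed
  ultimately show ?thesis by (simp add: algebra_simps)
qed

end

section \<open>Measurability and expectations\<close>

text \<open>Independence of the output index is given as independence of two families of preimages.
  The preimages under f and g form Int-stable subfamilies, so independence extends to the generated
  sigma-algebras.\<close>

lemma (in prob_space) indep_var_of_indep_set:
  fixes f g :: "'a \<Rightarrow> real"
  assumes ind: "indep_set {X -` A \<inter> space M | A. A \<in> \<A>} {Y -` B \<inter> space M | B. B \<in> \<B>}"
    and g: "\<And>S. S \<in> sets borel \<Longrightarrow> \<exists>B\<in>\<B>. g -` S \<inter> space M = Y -` B \<inter> space M"
    and f: "\<And>S. S \<in> sets borel \<Longrightarrow> \<exists>A\<in>\<A>. f -` S \<inter> space M = X -` A \<inter> space M"
  shows "indep_var borel f borel g"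
proof -
  let ?F = "{f -` S \<inter> space M | S. S \<in> sets borel}" and ?G = "{g -` S \<inter> space M | S. S \<in> sets borel}"
  let ?X = "{X -` A \<inter> space M | A. A \<in> \<A>}" and ?Y = "{Y -` B \<inter> space M | B. B \<in> \<B>}"
  have sub: "?F \<subseteq> ?X" "?G \<subseteq> ?Y"
  proof -
    have "f -` S \<inter> space M \<in> ?X" "g -` S \<inter> space M \<in> ?Y" if "S \<in> sets borel" for S
      using f[OF that] g[OF that] by auto
    then show "?F \<subseteq> ?X" "?G \<subseteq> ?Y" by fastforce+
  qed
  have ev: "?X \<subseteq> events" "?Y \<subseteq> events"
    by (rule indep_setD_ev1[OF ind], rule indep_setD_ev2[OF ind])
  have stable: "Int_stable {h -` S \<inter> space M | S. S \<in> sets borel}" for h :: "'a \<Rightarrow> real"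
  proof (rule Int_stableI)
    fix E F assume "E \<in> {h -` S \<inter> space M | S. S \<in> sets borel}" "F \<in> {h -` S \<inter> space M | S. S \<in> sets borel}"
    then obtain S S' where "E = h -` S \<inter> space M" "F = h -` S' \<inter> space M"
      and S: "S \<in> sets borel" "S' \<in> sets borel" by auto
    then have "E \<inter> F = h -` (S \<inter> S') \<inter> space M" by auto
    moreover have "S \<inter> S' \<in> sets borel" using S by auto
    ultimately show "E \<inter> F \<in> {h -` S \<inter> space M | S. S \<in> sets borel}" by blast
  qed
  have "indep_set ?F ?G"
  proof (rule indep_setI)
    show "?F \<subseteq> events" "?G \<subseteq> events"
      by (rule subset_trans[OF sub(1) ev(1)], rule subset_trans[OF sub(2) ev(2)])
    fix a b assume ab: "a \<in> ?F" "b \<in> ?G"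
    show "prob (a \<inter> b) = prob a * prob b"
      by (rule indep_setD[OF ind subsetD[OF sub(1) ab(1)] subsetD[OF sub(2) ab(2)]])
  qed
  then have "indep_set (sigma_sets (space M) ?F) (sigma_sets (space M) ?G)"
    by (rule indep_set_sigma_sets) (rule stable)+
  moreover have "f \<in> borel_measurable M" "g \<in> borel_measurable M"
    using subset_trans[OF sub(1) ev(1)] subset_trans[OF sub(2) ev(2)] by (auto intro!: measurableI)
  ultimately show ?thesis unfolding indep_var_eq by simp
qed

locale stochastic_fema = fema d X \<phi> \<rho> q w lb D P\<^sub>\<xi> G Gm T al b \<beta>\<^sub>2 \<beta>\<^sub>3 x\<^sub>0 qlo qhi +
    sample: prob_space P\<^sub>\<xi>
  for d X \<phi> \<rho> q w lb D and P\<^sub>\<xi> :: "'a measure" and G Gm T al b \<beta>\<^sub>2 \<beta>\<^sub>3 x\<^sub>0 qlo qhi +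
  fixes U :: "(nat \<Rightarrow> real) set"
  assumes X_U: "X \<subseteq> U"
    and G_meas: "(\<lambda>(x, s). G x s) \<in> measurable (restrict_space borel U \<Otimes>\<^sub>M P\<^sub>\<xi>) borel"
    and G_mean: "\<And>x i. x \<in> X \<Longrightarrow> i < d \<Longrightarrow> integrable P\<^sub>\<xi> (\<lambda>s. G x s i) \<and> (\<integral>s. G x s i \<partial>P\<^sub>\<xi>) = w x i"
begin

text \<open>G is jointly measurable over U only, so the first argument must take values in
  X.\<close>

lemma measurable_oracle:
  assumes "f \<in> borel_measurable N" "g \<in> measurable N P\<^sub>\<xi>" "\<And>\<omega>. \<omega> \<in> space N \<Longrightarrow> f \<omega> \<in> X"
  shows "(\<lambda>\<omega>. G (f \<omega>) (g \<omega>)) \<in> borel_measurable N"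
proof -
  have "f \<in> measurable N (restrict_space borel U)"
    using assms X_U by (intro measurable_restrict_space2) auto
  then have "(\<lambda>\<omega>. (f \<omega>, g \<omega>)) \<in> measurable N (restrict_space borel U \<Otimes>\<^sub>M P\<^sub>\<xi>)"
    using assms by (intro measurable_Pair)
  from measurable_compose[OF this G_meas] show ?thesis by simp
qed

section \<open>Measurability of the iterates\<close>

lemmas coord = measurable_product_then_coordinatewise

lemma measurable_as:
  "(\<lambda>\<omega>. vs (Y \<omega>) t) \<in> borel_measurable N \<Longrightarrow> (\<lambda>\<omega>. as (Y \<omega>) t) \<in> borel_measurable N"
  unfolding as_def
  by (rule measurable_coordinatewise_then_product, rule measurable_compose[OF coord borel_measurable_sqrt])

text \<open>The source space is left open because the same fact is used on the probability space
  itself, on products of samples, and on past paired with present.\<close>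

lemma measurable_state:
  assumes "\<And>s. s < t \<Longrightarrow> (\<lambda>\<omega>. Y \<omega> s) \<in> measurable N P\<^sub>\<xi>" "t \<le> Suc T"
  shows "(\<lambda>\<omega>. xs (Y \<omega>) t) \<in> borel_measurable N \<and> (\<lambda>\<omega>. ms (Y \<omega>) t) \<in> borel_measurable N
    \<and> (\<lambda>\<omega>. us (Y \<omega>) t) \<in> borel_measurable N \<and> (\<lambda>\<omega>. vs (Y \<omega>) t) \<in> borel_measurable N"
  using assms
proof (induction t)
  case 0
  then show ?case by (simp add: st_0)
next
  case (Suc t)
  then have x: "(\<lambda>\<omega>. xs (Y \<omega>) t) \<in> borel_measurable N"
    and m: "(\<lambda>\<omega>. ms (Y \<omega>) t) \<in> borel_measurable N"
    and u: "(\<lambda>\<omega>. us (Y \<omega>) t) \<in> borel_measurable N"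
    and v: "(\<lambda>\<omega>. vs (Y \<omega>) t) \<in> borel_measurable N" by auto
  have sp: "Y \<omega> s \<in> space P\<^sub>\<xi>" if "\<omega> \<in> space N" "s < Suc t" for \<omega> s
    using measurable_space[OF Suc.prems(1)] that by auto
  have "(\<lambda>\<omega>. G (xs (Y \<omega>) t) (Y \<omega> t)) \<in> borel_measurable N"
    using x Suc.prems xs_X sp by (intro measurable_oracle) auto
  then have g: "(\<lambda>\<omega>. G (xs (Y \<omega>) t) (Y \<omega> t) i) \<in> borel_measurable N" for i by (rule coord)
  have m': "(\<lambda>\<omega>. ms (Y \<omega>) (Suc t)) \<in> borel_measurable N"
    unfolding st_Suc(1) using g coord[OF m]
    by (intro measurable_coordinatewise_then_product borel_measurable_add borel_measurable_times) auto
  have u': "(\<lambda>\<omega>. us (Y \<omega>) (Suc t)) \<in> borel_measurable N"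
    unfolding st_Suc(2) using g coord[OF u]
    by (intro measurable_coordinatewise_then_product borel_measurable_add borel_measurable_times borel_measurable_power) auto
  have v': "(\<lambda>\<omega>. vs (Y \<omega>) (Suc t)) \<in> borel_measurable N"
    unfolding st_Suc(3) using coord[OF v] coord[OF u']
    by (intro measurable_coordinatewise_then_product borel_measurable_add borel_measurable_times borel_measurable_max) auto
  have "(\<lambda>\<omega>. xs (Y \<omega>) (Suc t)) \<in> borel_measurable N"
    unfolding st_Suc(4)
  proof (rule H.measurable_prox[OF al_pos measurable_as[OF v']])
    show "(\<lambda>\<omega> i. xs (Y \<omega>) t i - al * ms (Y \<omega>) (Suc t) i / as (Y \<omega>) (Suc t) i) \<in> borel_measurable N"
      using coord[OF x] coord[OF m'] coord[OF measurable_as[OF v']]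
      by (intro measurable_coordinatewise_then_product borel_measurable_diff borel_measurable_divide borel_measurable_times) auto
    fix \<omega> i assume "\<omega> \<in> space N" "i < d"
    then have "0 < as (Y \<omega>) (Suc t) i"
      using as_bounds(4)[of "Suc t" "Y \<omega>" i] sp Suc.prems(2) by auto
    then show "0 \<le> as (Y \<omega>) (Suc t) i \<and> 0 < as (Y \<omega>) (Suc t) i / al"
      using al_pos by auto
  qed
  with m' u' v' show ?case by auto
qed

lemma measurable_xs:
  "(\<And>s. s < t \<Longrightarrow> (\<lambda>\<omega>. Y \<omega> s) \<in> measurable N P\<^sub>\<xi>) \<Longrightarrow> t \<le> Suc T \<Longrightarrow> (\<lambda>\<omega>. xs (Y \<omega>) t) \<in> borel_measurable N"
  using measurable_state by blast

lemma measurable_as':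
  "(\<And>s. s < t \<Longrightarrow> (\<lambda>\<omega>. Y \<omega> s) \<in> measurable N P\<^sub>\<xi>) \<Longrightarrow> t \<le> Suc T \<Longrightarrow> (\<lambda>\<omega>. as (Y \<omega>) t) \<in> borel_measurable N"
  using measurable_state by (blast intro: measurable_as)

text \<open>Separate indices for metric and iterate cover both \<open>pt\<close> and
  \<open>pn\<close>.\<close>

lemma measurable_env_prox:
  assumes Y: "\<And>s. s < t \<Longrightarrow> (\<lambda>\<omega>. Y \<omega> s) \<in> measurable N P\<^sub>\<xi>" and "r \<le> t" "t \<le> Suc T"
  shows "(\<lambda>\<omega>. P \<zeta> (as (Y \<omega>) t) (xs (Y \<omega>) r)) \<in> borel_measurable N"
proof (rule measurable_prox[OF \<zeta>_pos])
  show "(\<lambda>\<omega>. as (Y \<omega>) t) \<in> borel_measurable N" "(\<lambda>\<omega>. xs (Y \<omega>) r) \<in> borel_measurable N"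
    using assms by (intro measurable_as' measurable_xs; auto)+
  fix \<omega> i assume \<omega>: "\<omega> \<in> space N" "i < d"
  then have "Y \<omega> s \<in> space P\<^sub>\<xi>" if "s < t" for s
    using measurable_space[OF Y] that by auto
  then show "0 \<le> as (Y \<omega>) t i \<and> \<rho> * q i < as (Y \<omega>) t i / \<zeta>"
    using as_bounds(1)[of t "Y \<omega>"] assms(3) \<omega>(2) by (intro admissible) auto
qed

lemma measurable_gap:
  assumes "\<And>s. s < t \<Longrightarrow> (\<lambda>\<omega>. Y \<omega> s) \<in> measurable N P\<^sub>\<xi>" "t \<le> T"
  shows "(\<lambda>\<omega>. pt (Y \<omega>) t) \<in> borel_measurable N" "(\<lambda>\<omega>. gap (Y \<omega>) t) \<in> borel_measurable N"
proof -
  show pt: "(\<lambda>\<omega>. pt (Y \<omega>) t) \<in> borel_measurable N"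
    unfolding pt_def using assms by (intro measurable_env_prox) auto
  have "(\<lambda>\<omega>. as (Y \<omega>) t) \<in> borel_measurable N" "(\<lambda>\<omega>. xs (Y \<omega>) t) \<in> borel_measurable N"
    using assms by (intro measurable_as' measurable_xs; auto)+
  from this[THEN coord] coord[OF pt] show "(\<lambda>\<omega>. gap (Y \<omega>) t) \<in> borel_measurable N"
    unfolding gap_def wsq_def
    by (intro borel_measurable_sum borel_measurable_times borel_measurable_power borel_measurable_diff) auto
qed

lemma measurable_gsq:
  assumes "\<And>s. s < Suc t \<Longrightarrow> (\<lambda>\<omega>. Y \<omega> s) \<in> measurable N P\<^sub>\<xi>" "t \<le> T"
  shows "(\<lambda>\<omega>. gsq (Y \<omega>) t) \<in> borel_measurable N"
proof -
  have pn: "(\<lambda>\<omega>. pn (Y \<omega>) t) \<in> borel_measurable N"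
    unfolding pn_def using assms by (intro measurable_env_prox) auto
  have "(\<lambda>\<omega>. as (Y \<omega>) (Suc t)) \<in> borel_measurable N" "(\<lambda>\<omega>. xs (Y \<omega>) t) \<in> borel_measurable N"
    using assms by (intro measurable_as' measurable_xs; auto)+
  from this[THEN coord] coord[OF pn] show ?thesis
    unfolding gsq_def
    by (intro borel_measurable_sum borel_measurable_times borel_measurable_power borel_measurable_diff
        borel_measurable_divide) auto
qed

text \<open>\<open>ip\<close> with the current sample split off from the path, so that it can be
  integrated while the past is frozen.\<close>

definition "ipk y t s = (\<Sum>i<d. G (xs y t) s i * (pt y t i - xs y t i))"

lemma measurable_kernel:
  assumes "\<And>s. s < t \<Longrightarrow> (\<lambda>\<omega>. Y \<omega> s) \<in> measurable N P\<^sub>\<xi>" "t \<le> T" and S: "S \<in> measurable N P\<^sub>\<xi>"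
  shows "(\<lambda>\<omega>. ipk (Y \<omega>) t (S \<omega>)) \<in> borel_measurable N"
proof -
  have x: "(\<lambda>\<omega>. xs (Y \<omega>) t) \<in> borel_measurable N"
    using assms by (intro measurable_xs) auto
  have "(\<lambda>\<omega>. G (xs (Y \<omega>) t) (S \<omega>)) \<in> borel_measurable N"
    using measurable_space[OF assms(1)] assms(2) by (intro measurable_oracle x S xs_X) auto
  from coord[OF this] coord[OF x] coord[OF measurable_gap(1)[OF assms(1,2)]] show ?thesis
    unfolding ipk_def
    by (intro borel_measurable_sum borel_measurable_times borel_measurable_diff) auto
qed

text \<open>With the past frozen, the sample enters only through G, linearly; the mean turns G into
  the subgradient \<open>w\<close> and \<open>subgrad_angle\<close> applies.\<close>

lemma integral_kernel_le:
  assumes y: "\<And>s. s < t \<Longrightarrow> y s \<in> space P\<^sub>\<xi>" and t: "t \<le> T"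
  shows "(\<integral>s. ipk y t s \<partial>P\<^sub>\<xi>) \<le> - (\<rho> * \<kappa> * gap y t)"
proof -
  have x: "xs y t \<in> X" using xs_X[of t y] y t by auto
  have "(\<integral>s. ipk y t s \<partial>P\<^sub>\<xi>) = (\<Sum>i<d. w (xs y t) i * (pt y t i - xs y t i))"
    unfolding ipk_def using G_mean[OF x] by (subst Bochner_Integration.integral_sum) auto
  also have "\<dots> \<le> - (\<rho> * \<kappa> * gap y t)"
    using subgrad_angle[OF _ x, of "as y t"] as_bounds(1)[of t y] y t
    by (simp add: dot_def gap_def pt_def)
  finally show ?thesis .
qed

lemma ip_kernel: "ip xi t = ipk xi t (xi t)"
  by (simp add: ip_def ipk_def)

lemma kernel_cong: "(\<And>s. s < t \<Longrightarrow> y s = y' s) \<Longrightarrow> ipk y t = ipk y' t"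
  unfolding ipk_def[abs_def] pt_def using st_cong[of t y y'] by presburger

lemma gap_cong: "(\<And>s. s < t \<Longrightarrow> y s = y' s) \<Longrightarrow> gap y t = gap y' t"
  unfolding gap_def pt_def using st_cong[of t y y'] by presburger

lemma gsq_cong: "(\<And>s. s < Suc t \<Longrightarrow> y s = y' s) \<Longrightarrow> gsq y t = gsq y' t"
  using st_cong[of t y y'] st_cong[of "Suc t" y y'] by (auto simp: gsq_def pn_def)

end

locale fema_run = stochastic_fema d X \<phi> \<rho> q w lb D P\<^sub>\<xi> G Gm T al b \<beta>\<^sub>2 \<beta>\<^sub>3 x\<^sub>0 qlo qhi U + prob_space M
  for d X \<phi> \<rho> q w lb D and P\<^sub>\<xi> :: "'a measure" and G Gm T al b \<beta>\<^sub>2 \<beta>\<^sub>3 x\<^sub>0 qlo qhi U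
    and M :: "'w measure" +
  fixes \<xi> :: "nat \<Rightarrow> 'w \<Rightarrow> 'a"
  assumes \<xi>_indep: "indep_vars (\<lambda>_. P\<^sub>\<xi>) \<xi> {..T}" and \<xi>_distr: "\<And>t. t \<le> T \<Longrightarrow> distr M P\<^sub>\<xi> (\<xi> t) = P\<^sub>\<xi>"
begin

section \<open>Expectations over the samples\<close>

abbreviation "smp \<omega> \<equiv> \<lambda>s. \<xi> s \<omega>"

lemma \<xi>_meas: "t \<le> T \<Longrightarrow> \<xi> t \<in> measurable M P\<^sub>\<xi>"
  using \<xi>_indep unfolding indep_vars_def by auto

lemma path_space: "\<omega> \<in> space M \<Longrightarrow> s \<le> T \<Longrightarrow> smp \<omega> s \<in> space P\<^sub>\<xi>"
  using measurable_space[OF \<xi>_meas] by auto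

lemma path_valid: "\<omega> \<in> space M \<Longrightarrow> valid (smp \<omega>)"
  using path_space by (auto simp: valid_def)

lemma gap_integrable: "t \<le> T \<Longrightarrow> integrable M (\<lambda>\<omega>. gap (smp \<omega>) t)"
  using gap_bound[of t "smp _"] path_space
  by (intro integrable_const_bound[where B = "D\<^sup>2 * (d * A)"] AE_I2 measurable_gap \<xi>_meas) auto

lemma ip_integrable: "t \<le> T \<Longrightarrow> integrable M (\<lambda>\<omega>. ip (smp \<omega>) t)"
  unfolding ip_kernel using ip_bound[of t "smp _", unfolded ip_kernel] path_space
  by (intro integrable_const_bound[where B = "d * (Gm * D)"] AE_I2 measurable_kernel \<xi>_meas) auto

lemma gsq_integrable:
  assumes t: "t \<le> T" shows "integrable M (\<lambda>\<omega>. gsq (smp \<omega>) t)"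
proof (rule integrable_const_bound)
  show "(\<lambda>\<omega>. gsq (smp \<omega>) t) \<in> borel_measurable M"
    using t by (intro measurable_gsq \<xi>_meas) auto
  show "AE \<omega> in M. norm (gsq (smp \<omega>) t)
      \<le> 8 * \<rho>\<^sup>2 * A\<^sup>2 / sqrt qlo * (D\<^sup>2 * (d * A) + 2 * D\<^sup>2 / \<kappa> * (d * A))"
  proof (rule AE_I2)
    fix \<omega> assume \<omega>: "\<omega> \<in> space M"
    have s: "smp \<omega> s \<in> space P\<^sub>\<xi>" if "s < Suc t" for s using path_space[OF \<omega>] that t by auto
    have "gsq (smp \<omega>) t \<le> 8 * \<rho>\<^sup>2 * A\<^sup>2 / sqrt qlo * (gap (smp \<omega>) t + 2 * D\<^sup>2 / \<kappa> * incr (smp \<omega>) t)"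
      by (rule gsq_le[OF s t])
    also have "\<dots> \<le> 8 * \<rho>\<^sup>2 * A\<^sup>2 / sqrt qlo * (D\<^sup>2 * (d * A) + 2 * D\<^sup>2 / \<kappa> * (d * A))"
      using gap_bound(2)[OF s t] incr_bound[OF path_valid[OF \<omega>] t] qlo_pos \<kappa>_pos
      by (intro mult_left_mono add_mono) auto
    finally show "norm (gsq (smp \<omega>) t) \<le> \<dots>"
      using gsq_nonneg[OF s t] by simp
  qed
qed

text \<open>The tower property is carried out by Fubini: past and present samples are independent,
  so their joint law is a product and the inner integral is
  \<open>integral_kernel_le\<close>.\<close>

lemma expectation_ip_le:
  assumes t: "t \<le> T"
  shows "(\<integral>\<omega>. ip (smp \<omega>) t \<partial>M) \<le> - (\<rho> * \<kappa> * (\<integral>\<omega>. gap (smp \<omega>) t \<partial>M))"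
proof -
  define N where "N = PiM {..<t} (\<lambda>_. P\<^sub>\<xi>)"
  define Y where "Y \<omega> = (\<lambda>s\<in>{..<t}. \<xi> s \<omega>)" for \<omega>
  define N' where "N' = PiM {t} (\<lambda>_. P\<^sub>\<xi>)"
  \<comment> \<open>Independence of blocks delivers the present sample as a function on the
    singleton {t}; \<open>proj\<close> unpacks it.\<close>
  define R where "R \<omega> = (\<lambda>s\<in>{t}. \<xi> s \<omega>)" for \<omega>
  have ind: "indep_var N Y N' R"
    unfolding N_def Y_def N'_def R_def using t by (intro indep_var_restrict[OF \<xi>_indep]) auto
  have Y: "Y \<in> measurable M N" and R: "R \<in> measurable M N'"
    using ind indep_var_rv1 indep_var_rv2 by blast+
  have joint: "distr M N Y \<Otimes>\<^sub>M distr M N' R = distr M (N \<Otimes>\<^sub>M N') (\<lambda>\<omega>. (Y \<omega>, R \<omega>))"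
    using ind unfolding indep_var_distribution_eq by simp
  have proj: "(\<lambda>r. r t) \<in> measurable N' P\<^sub>\<xi>"
    unfolding N'_def by (rule measurable_component_singleton) simp
  interpret dY: prob_space "distr M N Y" by (rule prob_space_distr[OF Y])
  interpret dR: prob_space "distr M N' R" by (rule prob_space_distr[OF R])
  interpret pair_sigma_finite "distr M N Y" "distr M N' R" ..
  define K where "K = (\<lambda>p. ipk (fst p) t (snd p t))"
  have K: "K \<in> borel_measurable (N \<Otimes>\<^sub>M N')"
    unfolding K_def using t
    by (intro measurable_kernel measurable_compose[OF measurable_snd proj] measurable_compose[OF measurable_fst])
       (auto simp: N_def intro: measurable_component_singleton)
  have YK: "K (Y \<omega>, R \<omega>) = ip (smp \<omega>) t" for \<omega>
    unfolding K_def ip_kernel using kernel_cong[of t "Y \<omega>" "smp \<omega>"] by (simp add: Y_def R_def)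
  have Yg: "gap (Y \<omega>) t = gap (smp \<omega>) t" for \<omega>
    using gap_cong[of t "Y \<omega>" "smp \<omega>"] by (simp add: Y_def)
  have pm: "(\<lambda>\<omega>. (Y \<omega>, R \<omega>)) \<in> measurable M (N \<Otimes>\<^sub>M N')"
    by (intro measurable_Pair Y R)
  have Kint: "integrable (distr M N Y \<Otimes>\<^sub>M distr M N' R) K"
    unfolding joint integrable_distr_eq[OF pm K] YK by (rule ip_integrable[OF t])
  have g: "(\<lambda>y. gap y t) \<in> borel_measurable N"
    using t by (intro measurable_gap) (auto simp: N_def intro: measurable_component_singleton)
  have inner: "(\<integral>r. K (y, r) \<partial>distr M N' R) \<le> - (\<rho> * \<kappa> * gap y t)" if y: "y \<in> space N" for y
  proof -
    have ys: "y s \<in> space P\<^sub>\<xi>" if "s < t" for s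
      using y that by (auto simp: N_def space_PiM)
    have k: "(\<lambda>s. ipk y t s) \<in> borel_measurable P\<^sub>\<xi>"
      using ys t by (intro measurable_kernel measurable_const measurable_ident) auto
    have "(\<integral>r. K (y, r) \<partial>distr M N' R) = (\<integral>\<omega>. ipk y t (R \<omega> t) \<partial>M)"
      unfolding K_def fst_conv snd_conv by (rule integral_distr[OF R measurable_compose[OF proj k]])
    also have "\<dots> = (\<integral>\<omega>. ipk y t (\<xi> t \<omega>) \<partial>M)" by (simp add: R_def)
    also have "\<dots> = (\<integral>s. ipk y t s \<partial>distr M P\<^sub>\<xi> (\<xi> t))"
      by (rule integral_distr[OF \<xi>_meas[OF t] k, symmetric])
    also have "\<dots> \<le> - (\<rho> * \<kappa> * gap y t)"
      unfolding \<xi>_distr[OF t] by (rule integral_kernel_le[OF ys t])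
    finally show ?thesis .
  qed
  have "(\<integral>\<omega>. ip (smp \<omega>) t \<partial>M) = (\<integral>p. K p \<partial>(distr M N Y \<Otimes>\<^sub>M distr M N' R))"
    unfolding joint integral_distr[OF pm K] YK ..
  also have "\<dots> = (\<integral>y. (\<integral>r. K (y, r) \<partial>distr M N' R) \<partial>distr M N Y)"
    by (rule integral_fst'[symmetric, OF Kint])
  also have "\<dots> \<le> (\<integral>y. - (\<rho> * \<kappa> * gap y t) \<partial>distr M N Y)"
  proof (rule integral_mono)
    show "integrable (distr M N Y) (\<lambda>y. \<integral>r. K (y, r) \<partial>distr M N' R)"
      by (rule integrable_fst'[OF Kint])
    show "integrable (distr M N Y) (\<lambda>y. - (\<rho> * \<kappa> * gap y t))"
      using g by (subst integrable_distr_eq[OF Y]) (auto simp: Yg intro!: gap_integrable t)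
  qed (use inner in auto)
  also have "\<dots> = - (\<rho> * \<kappa> * (\<integral>y. gap y t \<partial>distr M N Y))" by simp
  also have "(\<integral>y. gap y t \<partial>distr M N Y) = (\<integral>\<omega>. gap (smp \<omega>) t \<partial>M)"
    unfolding integral_distr[OF Y g] Yg ..
  finally show ?thesis .
qed

text \<open>A deterministic quantity: initial envelope gap, total metric growth, momentum bias and
  accumulated squared steps.\<close>

definition "budget = obj \<zeta> (\<lambda>i. sqrt (q i)) x\<^sub>0 (P \<zeta> (\<lambda>i. sqrt (q i)) x\<^sub>0) - lb + d * (\<rho> * D\<^sup>2 * A
    + 4 * \<rho> * al * Gm * D * (\<Sum>t\<le>T. b t) + (T + 1) * (\<rho> * al\<^sup>2 * Gm\<^sup>2 / sqrt qlo))"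

lemma sum_expectation_gap_le:
  "2 * \<rho>\<^sup>2 * \<kappa> * al * (\<Sum>t\<le>T. \<integral>\<omega>. gap (smp \<omega>) t \<partial>M) \<le> budget"
proof -
  have "- budget \<le> (\<integral>\<omega>. 2 * \<rho> * al * (\<Sum>t\<le>T. ip (smp \<omega>) t) \<partial>M)"
  proof (rule integral_ge_const)
    show "integrable M (\<lambda>\<omega>. 2 * \<rho> * al * (\<Sum>t\<le>T. ip (smp \<omega>) t))"
      by (intro integrable_mult_right Bochner_Integration.integrable_sum ip_integrable) auto
    show "AE \<omega> in M. - budget \<le> 2 * \<rho> * al * (\<Sum>t\<le>T. ip (smp \<omega>) t)"
    proof (rule AE_I2)
      fix \<omega> assume "\<omega> \<in> space M"
      from sum_ip[OF path_valid[OF this]]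
      show "- budget \<le> 2 * \<rho> * al * (\<Sum>t\<le>T. ip (smp \<omega>) t)"
        by (simp add: budget_def env_def pt_def as_def[abs_def] st_0)
    qed
  qed
  also have "\<dots> = 2 * \<rho> * al * (\<Sum>t\<le>T. \<integral>\<omega>. ip (smp \<omega>) t \<partial>M)"
    using ip_integrable by (simp add: Bochner_Integration.integral_sum)
  also have "\<dots> \<le> 2 * \<rho> * al * (\<Sum>t\<le>T. - (\<rho> * \<kappa> * (\<integral>\<omega>. gap (smp \<omega>) t \<partial>M)))"
    using \<rho>_pos al_pos by (intro mult_left_mono sum_mono expectation_ip_le) auto
  finally show ?thesis
    by (simp add: sum_negf sum_distrib_left[symmetric] power2_eq_square mult_ac)
qed

lemma sum_expectation_gsq_le:
  "(\<Sum>t\<le>T. \<integral>\<omega>. gsq (smp \<omega>) t \<partial>M)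
    \<le> 8 * \<rho>\<^sup>2 * A\<^sup>2 / sqrt qlo * (budget / (2 * \<rho>\<^sup>2 * \<kappa> * al) + 2 * D\<^sup>2 / \<kappa> * (d * A))"
proof -
  define c1 where "c1 = 8 * \<rho>\<^sup>2 * A\<^sup>2 / sqrt qlo"
  have c1: "0 \<le> c1" using qlo_pos by (simp add: c1_def)
  define c2 where "c2 = 2 * D\<^sup>2 / \<kappa>"
  have c2: "0 \<le> c2" using \<kappa>_pos by (simp add: c2_def)
  have "(\<Sum>t\<le>T. \<integral>\<omega>. gsq (smp \<omega>) t \<partial>M) = (\<integral>\<omega>. (\<Sum>t\<le>T. gsq (smp \<omega>) t) \<partial>M)"
    using gsq_integrable by (simp add: Bochner_Integration.integral_sum)
  also have "\<dots> \<le> (\<integral>\<omega>. c1 * ((\<Sum>t\<le>T. gap (smp \<omega>) t) + c2 * (d * A)) \<partial>M)"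
  proof (rule integral_mono)
    show "integrable M (\<lambda>\<omega>. \<Sum>t\<le>T. gsq (smp \<omega>) t)"
      by (intro Bochner_Integration.integrable_sum gsq_integrable) auto
    show "integrable M (\<lambda>\<omega>. c1 * ((\<Sum>t\<le>T. gap (smp \<omega>) t) + c2 * (d * A)))"
      by (intro integrable_mult_right Bochner_Integration.integrable_add Bochner_Integration.integrable_sum gap_integrable) auto
    fix \<omega> assume \<omega>: "\<omega> \<in> space M"
    have "(\<Sum>t\<le>T. gsq (smp \<omega>) t) \<le> (\<Sum>t\<le>T. c1 * (gap (smp \<omega>) t + c2 * incr (smp \<omega>) t))"
      unfolding c1_def c2_def using path_space[OF \<omega>] by (intro sum_mono gsq_le) auto
    also have "\<dots> = c1 * ((\<Sum>t\<le>T. gap (smp \<omega>) t) + c2 * (\<Sum>t\<le>T. incr (smp \<omega>) t))"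
      by (simp add: sum_distrib_left[symmetric] sum.distrib)
    also have "\<dots> \<le> c1 * ((\<Sum>t\<le>T. gap (smp \<omega>) t) + c2 * (d * A))"
      using sum_incr[OF path_valid[OF \<omega>]] c1 c2 by (intro mult_left_mono add_mono) auto
    finally show "(\<Sum>t\<le>T. gsq (smp \<omega>) t) \<le> c1 * ((\<Sum>t\<le>T. gap (smp \<omega>) t) + c2 * (d * A))" .
  qed
  also have "\<dots> = c1 * ((\<Sum>t\<le>T. \<integral>\<omega>. gap (smp \<omega>) t \<partial>M) + c2 * (d * A))"
  proof -
    have "integrable M (\<lambda>\<omega>. \<Sum>t\<le>T. gap (smp \<omega>) t)"
      by (intro Bochner_Integration.integrable_sum gap_integrable) auto
    then show ?thesis
      using gap_integrable by (simp add: Bochner_Integration.integral_sum prob_space)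
  qed
  also have "\<dots> \<le> c1 * (budget / (2 * \<rho>\<^sup>2 * \<kappa> * al) + c2 * (d * A))"
  proof (intro mult_left_mono add_mono c1)
    have "0 < 2 * \<rho>\<^sup>2 * \<kappa> * al" using \<rho>_pos \<kappa>_pos al_pos by simp
    then show "(\<Sum>t\<le>T. \<integral>\<omega>. gap (smp \<omega>) t \<partial>M) \<le> budget / (2 * \<rho>\<^sup>2 * \<kappa> * al)"
      using sum_expectation_gap_le by (simp add: pos_le_divide_eq mult.commute)
  qed (auto simp: c2)
  finally show ?thesis unfolding c1_def c2_def .
qed

text \<open>The random index is removed by summing over its values: each indicator is independent of
  the path functional at a fixed t, so expectations factor.\<close>

lemma random_index:
  assumes ts: "ts \<in> measurable M (count_space UNIV)" "\<And>\<omega>. \<omega> \<in> space M \<Longrightarrow> ts \<omega> \<le> T"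
    and unif: "\<And>t. t \<le> T \<Longrightarrow> prob {\<omega> \<in> space M. ts \<omega> = t} = p"
    and indep: "indep_set {ts -` A \<inter> space M | A. A \<in> UNIV}
       {(\<lambda>\<omega>. \<lambda>t\<in>{..T}. \<xi> t \<omega>) -` B \<inter> space M | B. B \<in> sets (PiM {..T} (\<lambda>_. P\<^sub>\<xi>))}"
  shows "integrable M (\<lambda>\<omega>. gsq (smp \<omega>) (ts \<omega>))"
    and "(\<integral>\<omega>. gsq (smp \<omega>) (ts \<omega>) \<partial>M) = p * (\<Sum>t\<le>T. \<integral>\<omega>. gsq (smp \<omega>) t \<partial>M)"
proof -
  let ?N = "PiM {..T} (\<lambda>_. P\<^sub>\<xi>)"
  let ?Y = "\<lambda>\<omega>. \<lambda>t\<in>{..T}. \<xi> t \<omega>"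
  have Y: "?Y \<in> measurable M ?N" by (intro measurable_restrict \<xi>_meas) auto
  define I where "I t \<omega> = (if ts \<omega> = t then 1 else 0 :: real)" for t \<omega>
  have Yg: "gsq (?Y \<omega>) t = gsq (smp \<omega>) t" if "t \<le> T" for t \<omega>
    using that by (intro gsq_cong) auto
  have pr: "integrable M (\<lambda>\<omega>. I t \<omega> * gsq (smp \<omega>) t)"
    "(\<integral>\<omega>. I t \<omega> * gsq (smp \<omega>) t \<partial>M) = p * (\<integral>\<omega>. gsq (smp \<omega>) t \<partial>M)" if t: "t \<le> T" for t
  proof -
    have gN: "(\<lambda>y. gsq y t) \<in> borel_measurable ?N"
      using t by (intro measurable_gsq measurable_component_singleton) auto
    have iv: "indep_var borel (I t) borel (\<lambda>\<omega>. gsq (smp \<omega>) t)"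
    proof (rule indep_var_of_indep_set[OF indep])
      show "\<exists>B\<in>sets ?N. (\<lambda>\<omega>. gsq (smp \<omega>) t) -` S \<inter> space M = ?Y -` B \<inter> space M" if "S \<in> sets borel" for S
      proof
        show "(\<lambda>y. gsq y t) -` S \<inter> space ?N \<in> sets ?N" by (rule measurable_sets[OF gN that])
        show "(\<lambda>\<omega>. gsq (smp \<omega>) t) -` S \<inter> space M = ?Y -` ((\<lambda>y. gsq y t) -` S \<inter> space ?N) \<inter> space M"
          using measurable_space[OF Y] Yg[OF t] by auto
      qed
      show "\<exists>A\<in>UNIV. I t -` S \<inter> space M = ts -` A \<inter> space M" for S
        by (rule bexI[of _ "(\<lambda>u. if u = t then 1 else 0 :: real) -` S"]) (auto simp: I_def)
    qed
    have I_eq: "I t \<omega> = indicator {\<omega> \<in> space M. ts \<omega> = t} \<omega>" if "\<omega> \<in> space M" for \<omega>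
      using that by (simp add: I_def)
    have ev: "{\<omega> \<in> space M. ts \<omega> = t} \<in> events"
      using measurable_sets[OF ts(1), of "{t}"] by (simp add: vimage_def Int_def conj_commute)
    have Iint: "integrable M (I t)"
      using ev by (subst Bochner_Integration.integrable_cong[OF refl I_eq])
        (auto intro!: integrable_real_indicator simp: less_top[symmetric])
    have "(\<integral>\<omega>. I t \<omega> \<partial>M) = p"
      using ev unif[OF t] by (subst Bochner_Integration.integral_cong[OF refl I_eq]) auto
    then show "(\<integral>\<omega>. I t \<omega> * gsq (smp \<omega>) t \<partial>M) = p * (\<integral>\<omega>. gsq (smp \<omega>) t \<partial>M)"
      using indep_var_lebesgue_integral[OF iv Iint gsq_integrable[OF t]] by simp
    show "integrable M (\<lambda>\<omega>. I t \<omega> * gsq (smp \<omega>) t)"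
      by (rule indep_var_integrable[OF iv Iint gsq_integrable[OF t]])
  qed
  have eq: "gsq (smp \<omega>) (ts \<omega>) = (\<Sum>t\<le>T. I t \<omega> * gsq (smp \<omega>) t)" if "\<omega> \<in> space M" for \<omega>
    using ts(2)[OF that] by (simp add: I_def if_distrib[of "\<lambda>u. u * _"] cong: if_cong)
  show "integrable M (\<lambda>\<omega>. gsq (smp \<omega>) (ts \<omega>))"
    by (subst Bochner_Integration.integrable_cong[OF refl eq]) (auto intro!: Bochner_Integration.integrable_sum pr)
  have "(\<integral>\<omega>. gsq (smp \<omega>) (ts \<omega>) \<partial>M) = (\<Sum>t\<le>T. \<integral>\<omega>. I t \<omega> * gsq (smp \<omega>) t \<partial>M)"
    using pr by (subst Bochner_Integration.integral_cong[OF refl eq]) (auto intro!: Bochner_Integration.integral_sum)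
  also have "\<dots> = p * (\<Sum>t\<le>T. \<integral>\<omega>. gsq (smp \<omega>) t \<partial>M)"
    by (simp add: pr sum_distrib_left)
  finally show "(\<integral>\<omega>. gsq (smp \<omega>) (ts \<omega>) \<partial>M) = p * (\<Sum>t\<le>T. \<integral>\<omega>. gsq (smp \<omega>) t \<partial>M)" .
qed

end

section \<open>The rate\<close>

text \<open>The quadratic added in the definition is cancelled exactly by
  \<open>wsq_convex_comb\<close>, based at the origin, leaving the form \<open>curv\<close>.\<close>

lemma weakly_convex_combination:
  assumes wc: "weakly_convex d \<rho> q f" and q: "\<And>i. i < d \<Longrightarrow> 0 \<le> q i"
    and x: "x \<in> Rd d" "f x = ereal fx" and y: "y \<in> Rd d" "f y = ereal fy" and t: "0 < t" "t < 1"
  shows "f (\<lambda>i. (1 - t) * x i + t * y i)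
    \<le> ereal ((1 - t) * fx + t * fy + t * (1 - t) / 2 * wsq d (\<lambda>i. \<rho> * q i) y x)"
proof -
  let ?z = "\<lambda>i. (1 - t) * x i + t * y i"
  have wn: "(wnorm d q v)\<^sup>2 = wsq d q (\<lambda>_. 0) v" for v
    using wnorm_sq[where d = d and a = q and x = v and y = "\<lambda>_. 0", OF q] by (simp add: wsq_commute)
  have z: "?z \<in> Rd d" using x y by (simp add: Rd_def)
  have "f ?z + ereal (\<rho> / 2 * wsq d q (\<lambda>_. 0) ?z)
      \<le> ereal (1 - t) * (f x + ereal (\<rho> / 2 * wsq d q (\<lambda>_. 0) x)) + ereal t * (f y + ereal (\<rho> / 2 * wsq d q (\<lambda>_. 0) y))"
    using wc x(1) y(1) t unfolding weakly_convex_def convex_fun_def wn by auto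
  then show ?thesis
    using wc z unfolding x(2) y(2) wsq_convex_comb wsq_scale weakly_convex_def
    by (cases "f ?z") (auto simp: algebra_simps add_divide_distrib diff_divide_distrib)
qed

text \<open>A first-order inequality near x becomes global: on the segment to y it is combined with
  weak convexity, and division by the segment parameter removes the scale.\<close>

lemma frechet_subgradient_inequality:
  assumes wc: "weakly_convex d \<rho> q f" and \<rho>: "0 \<le> \<rho>" and q: "\<And>i. i < d \<Longrightarrow> 0 \<le> q i"
    and x: "x \<in> Rd d" "f x = ereal fx" and y: "y \<in> Rd d" "f y = ereal fy"
    and w: "w \<in> frechet_subdiff d q f x"
  shows "fx + dot d w (\<lambda>i. y i - x i) - 1 / 2 * wsq d (\<lambda>i. \<rho> * q i) y x \<le> fy"
proof (cases "y = x")
  case True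
  then show ?thesis using x y by (simp add: dot_def)
next
  case False
  then obtain j where j: "y j \<noteq> x j" by auto
  define W where "W = wsq d (\<lambda>i. \<rho> * q i) y x"
  have W: "0 \<le> W" unfolding W_def using \<rho> q by (intro wsq_nonneg) auto
  define z where "z s i = (1 - s) * x i + s * y i" for s :: real and i
  have zx: "z s i - x i = s * (y i - x i)" for s i by (simp add: z_def algebra_simps)
  define n where "n = wnorm d q (\<lambda>i. y i - x i)"
  have n: "0 \<le> n" by (simp add: n_def wnorm_def)
  define g where "g = dot d w (\<lambda>i. y i - x i)"
  have dot: "dot d w (\<lambda>i. z s i - x i) = s * g" for s
    unfolding zx g_def dot_def sum_distrib_left by (simp add: mult_ac)
  have wn: "wnorm d q (\<lambda>i. z s i - x i) = s * n" if "0 \<le> s" for s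
    using L2_set_right_distrib[OF that, of "\<lambda>i. sqrt (q i) * (y i - x i)" "{..<d}"]
    unfolding zx n_def wnorm_def by (simp add: mult_ac)
  have lim: "filterlim z (at x within Rd d) (at_right 0)"
    unfolding filterlim_at
  proof
    show "\<forall>\<^sub>F s in at_right 0. z s \<in> Rd d \<and> z s \<noteq> x"
      unfolding eventually_at_filter
    proof (intro always_eventually allI impI conjI)
      fix s :: real assume "s \<noteq> 0" "s \<in> {0<..}"
      then have "z s j - x j \<noteq> 0" using j unfolding zx by auto
      then show "z s \<noteq> x" by auto
      show "z s \<in> Rd d" using x y by (simp add: z_def Rd_def)
    qed
    have "((\<lambda>s. z s i) \<longlongrightarrow> (1 - 0) * x i + 0 * y i) (at_right 0)" for i
      unfolding z_def by (intro tendsto_intros)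
    then show "(z \<longlongrightarrow> x) (at_right 0)"
      by (intro tendsto_coordinatewise_fun) auto
  qed
  have main: "g - \<epsilon> * n \<le> fy - fx + 1 / 2 * W" if \<epsilon>: "0 < \<epsilon>" for \<epsilon>
  proof -
    have "\<forall>\<^sub>F v in at x within Rd d.
        f v \<ge> f x + ereal (dot d w (\<lambda>i. v i - x i) - \<epsilon> * wnorm d q (\<lambda>i. v i - x i))"
      using w \<epsilon> by (auto simp: frechet_subdiff_def)
    from eventually_compose_filterlim[OF this lim]
    have "\<forall>\<^sub>F s in at_right 0.
        f (z s) \<ge> f x + ereal (dot d w (\<lambda>i. z s i - x i) - \<epsilon> * wnorm d q (\<lambda>i. z s i - x i))" .
    moreover have "\<forall>\<^sub>F s in at_right (0::real). s \<in> {0<..<1}"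
      by (rule eventually_at_right_real) simp
    ultimately have "\<forall>\<^sub>F s in at_right 0. s \<in> {0<..<1} \<and>
        f (z s) \<ge> f x + ereal (dot d w (\<lambda>i. z s i - x i) - \<epsilon> * wnorm d q (\<lambda>i. z s i - x i))"
      by eventually_elim auto
    \<comment> \<open>A single small s is enough, because (1 - s)/2 is simply bounded by
      1/2.\<close>
    from eventually_happens'[OF trivial_limit_at_right_real this]
    obtain s where s: "0 < s" "s < 1"
      and le': "f x + ereal (dot d w (\<lambda>i. z s i - x i) - \<epsilon> * wnorm d q (\<lambda>i. z s i - x i)) \<le> f (z s)"
      by auto
    have le: "f x + ereal (s * g - \<epsilon> * (s * n)) \<le> f (z s)"
      using le' s(1) unfolding dot by (simp add: wn)
    have "ereal (fx + (s * g - \<epsilon> * (s * n))) \<le> f (z s)" using le x(2) by simp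
    also have "\<dots> \<le> ereal ((1 - s) * fx + s * fy + s * (1 - s) / 2 * W)"
      using weakly_convex_combination[OF wc q x y s] unfolding W_def z_def[abs_def] by simp
    finally have "s * (g - \<epsilon> * n) \<le> s * (fy - fx + (1 - s) / 2 * W)"
      by (simp add: algebra_simps)
    then have "g - \<epsilon> * n \<le> fy - fx + (1 - s) / 2 * W" using s by simp
    also have "(1 - s) / 2 * W \<le> 1 / 2 * W" using s W by (intro mult_right_mono) auto
    finally show ?thesis by simp
  qed
  have "g \<le> fy - fx + 1 / 2 * W"
  proof (rule field_le_epsilon)
    fix e :: real assume e: "0 < e"
    \<comment> \<open>\<open>n\<close> may vanish, as \<open>q\<close> is only assumed nonnegative
      here; hence n + 1 in the denominator.\<close>
    have "e / (n + 1) * n \<le> e" using e n by (simp add: field_simps)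
    moreover have "g - e / (n + 1) * n \<le> fy - fx + 1 / 2 * W" using e n by (intro main) auto
    ultimately show "g \<le> fy - fx + 1 / 2 * W + e" by linarith
  qed
  then show ?thesis by (simp add: g_def W_def)
qed

lemma sum_decaying_momentum:
  fixes b :: "nat \<Rightarrow> real"
  assumes "0 < \<pi>" "\<pi> < 1" "0 \<le> \<beta>" "b 0 \<le> \<beta>" "\<And>t. t \<in> {1..T} \<Longrightarrow> b t = \<beta> * \<pi> ^ (t - 1)"
  shows "(\<Sum>t\<le>T. b t) \<le> \<beta> * (1 + 1 / (1 - \<pi>))"
proof -
  \<comment> \<open>Index 0 lies outside the geometric pattern, and the exponent t - 1 makes the
    tail start with power 0.\<close>
  have "(\<Sum>t\<le>T. b t) = b 0 + (\<Sum>t<T. b (Suc t))"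
    by (simp add: sum.atMost_shift)
  moreover have "(\<Sum>t<T. b (Suc t)) = \<beta> * (\<Sum>t<T. \<pi> ^ t)"
    using assms(5) by (simp add: sum_distrib_left)
  moreover have "\<beta> * (\<Sum>t<T. \<pi> ^ t) \<le> \<beta> * (1 / (1 - \<pi>))"
    using assms(1-3) by (intro mult_left_mono) (simp_all add: sum_gp_strict divide_right_mono)
  ultimately show ?thesis using assms(4) by (simp add: distrib_left)
qed

text \<open>The factor from \<open>gsq_le\<close> times the budget per dimension over 2\<rho>^2
  \<kappa> \<alpha>, plus the cost of switching metrics. \<Delta> enters in absolute value so that
  it can be multiplied by d.\<close>

definition fema_const :: "real \<Rightarrow> real \<Rightarrow> real \<Rightarrow> real \<Rightarrow> real \<Rightarrow> real \<Rightarrow> real \<Rightarrow> real \<Rightarrow> real \<Rightarrow> real" where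
  "fema_const \<rho> \<alpha> \<pi> \<beta> D Gm qlo qhi \<Delta> =
    8 * \<rho>\<^sup>2 * (sqrt (max qhi (Gm\<^sup>2)))\<^sup>2 / sqrt qlo *
      ((\<bar>\<Delta>\<bar> + \<rho> * D\<^sup>2 * sqrt (max qhi (Gm\<^sup>2)) + 4 * \<rho> * \<alpha> * Gm * D * (\<beta> * (1 + 1 / (1 - \<pi>)))
          + \<rho> * \<alpha>\<^sup>2 * Gm\<^sup>2 / sqrt qlo) / (2 * \<rho>\<^sup>2 * (2 - sqrt qhi) * \<alpha>)
        + 2 * D\<^sup>2 / (2 - sqrt qhi) * sqrt (max qhi (Gm\<^sup>2)))"

lemma fema_rate:
  fixes P :: "'a measure" and M :: "'w measure"
    and \<rho> \<alpha> \<pi> \<beta>\<^sub>1 \<beta>\<^sub>2 \<beta>\<^sub>3 D_inf G_inf qlo qhi \<Delta> \<psi>star :: real and d T :: nat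
    and X U :: "(nat \<Rightarrow> real) set" and f :: "(nat \<Rightarrow> real) \<Rightarrow> ereal"
    and q x\<^sub>0 b :: "nat \<Rightarrow> real" and G :: "(nat \<Rightarrow> real) \<Rightarrow> 'a \<Rightarrow> nat \<Rightarrow> real"
    and \<xi> :: "nat \<Rightarrow> 'w \<Rightarrow> 'a" and ts :: "'w \<Rightarrow> nat"
  defines "h \<equiv> indicator_fun X" and "\<psi> \<equiv> (\<lambda>x. f x + indicator_fun X x)"
    and "a \<equiv> (\<lambda>t::nat. \<alpha> / sqrt (real T + 1))"
  assumes par: "0 < \<rho>" "0 < \<alpha>" "0 < \<pi>" "\<pi> < 1" "0 \<le> \<beta>\<^sub>1" "\<beta>\<^sub>1 < 1"
    "0 < \<beta>\<^sub>2" "\<beta>\<^sub>2 < 1" "0 \<le> \<beta>\<^sub>3" "\<beta>\<^sub>3 < 1" "0 < qlo" "qhi < 2 * sqrt qhi"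
    and d: "0 < d" and T: "0 < T"
    and X: "X \<subseteq> Rd d" "X \<noteq> {}" "closed X" "convex_set X"
    and q: "\<forall>i<d. qlo \<le> q i \<and> q i \<le> qhi"
    and wc: "weakly_convex d \<rho> q f"
    and \<psi>star: "\<forall>z\<in>Rd d. ereal \<psi>star \<le> \<psi> z"
    and P: "prob_space P" and XU: "X \<subseteq> U"
    and G: "stoch_subgradient_oracle d q f U P G"
    and G_inf: "\<forall>z\<in>X. \<forall>s\<in>space P. linf d (G z s) \<le> G_inf"
    and D_inf: "\<forall>y\<in>X. \<forall>z\<in>X. linf d (\<lambda>i. y i - z i) \<le> D_inf"
    and b: "0 \<le> b 0" "b 0 \<le> \<beta>\<^sub>1" "\<forall>t\<in>{1..T}. b t = \<beta>\<^sub>1 * \<pi> ^ (t - 1)"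
    and x\<^sub>0: "x\<^sub>0 \<in> X"
    and \<Delta>: "moreau_env d \<psi> (1 / (2 * \<rho>)) (\<lambda>i. sqrt (q i)) x\<^sub>0 - ereal \<psi>star = ereal \<Delta>"
    and rnd: "fema_randomness T a P M \<xi> ts"
  defines "sq_grad \<equiv> (\<lambda>\<omega>. (L2_set
      (grad_env d \<psi> (1 / (2 * \<rho>)) (\<lambda>i. sqrt (fema_v d h G q a b \<beta>\<^sub>2 \<beta>\<^sub>3 x\<^sub>0 (\<lambda>t. \<xi> t \<omega>) (ts \<omega>) i))
        (fema_x d h G q a b \<beta>\<^sub>2 \<beta>\<^sub>3 x\<^sub>0 (\<lambda>t. \<xi> t \<omega>) (ts \<omega>))) {..<d})\<^sup>2)"
  shows "integrable M sq_grad \<and>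
    (\<integral>\<omega>. sq_grad \<omega> \<partial>M) \<le> fema_const \<rho> \<alpha> \<pi> \<beta>\<^sub>1 D_inf G_inf qlo qhi \<Delta> * (real d / sqrt (real T))"
proof -
  interpret P: prob_space P by (rule P)
  interpret M: prob_space M using rnd by (simp add: fema_randomness_def)
  define \<phi> where "\<phi> = (\<lambda>x. real_of_ereal (f x))"
  define al where "al = \<alpha> / sqrt (real T + 1)"
  have a: "a = (\<lambda>_. al)" by (simp add: a_def al_def)
  define w where "w x i = (\<integral>s. G x s i \<partial>P)" for x i
  have q0: "0 \<le> q i" if "i < d" for i using q par(11) that by force
  have sub: "w x \<in> frechet_subdiff d q f x" if "x \<in> X" for x
    using G that XU unfolding stoch_subgradient_oracle_def w_def[abs_def] by auto
  \<comment> \<open>Subdifferential membership excludes the value \<infinity> on X, and weak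
    convexity excludes -\<infinity>.\<close>
  have f_eq: "f x = ereal (\<phi> x)" if "x \<in> X" for x
  proof -
    have "f x \<noteq> \<infinity>" using sub[OF that] by (auto simp: frechet_subdiff_def)
    moreover have "f x \<noteq> -\<infinity>" using wc that X(1) by (auto simp: weakly_convex_def)
    ultimately show ?thesis by (cases "f x") (auto simp: \<phi>_def)
  qed
  have \<psi>: "\<psi> = ext_fun X \<phi>"
    by (auto simp: \<psi>_def ext_fun_def indicator_fun_def fun_eq_iff f_eq)
  have linf_D: "\<bar>v i\<bar> \<le> r" if "linf d v \<le> r" "i < d" for v r i
    using that by (auto simp: linf_def intro: order_trans[OF Max_ge])
  have D: "\<bar>y i - z i\<bar> \<le> D_inf" if "y \<in> X" "z \<in> X" "i < d" for y z i
    using linf_D[of "\<lambda>i. y i - z i"] D_inf that by auto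
  have Gb: "\<bar>G z s i\<bar> \<le> G_inf" if "z \<in> X" "s \<in> space P" "i < d" for z s i
    using linf_D[of "G z s"] G_inf that by auto
  obtain s0 where "s0 \<in> space P" using P.not_empty by auto
  then have G0: "0 \<le> G_inf" using Gb[OF x\<^sub>0 _ d, of s0] by linarith
  have D0: "0 \<le> D_inf" using D[OF x\<^sub>0 x\<^sub>0 d] by simp
  have qhi: "0 < qhi" using q d par(11) by force
  \<comment> \<open>Dividing the curvature hypothesis by sqrt qhi > 0 gives the form that makes
    \<kappa> positive.\<close>
  have "sqrt qhi * sqrt qhi < 2 * sqrt qhi" using par(12) qhi by simp
  then have qhi2: "sqrt qhi < 2" by (rule mult_right_less_imp_less) (use qhi in simp)
  have al: "0 < al" using par by (simp add: al_def)
  have b_range: "0 \<le> b t \<and> b t \<le> 1" if "t \<le> T" for t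
  proof (cases "t = 0")
    case True then show ?thesis using b par by auto
  next
    case False
    then have "b t = \<beta>\<^sub>1 * \<pi> ^ (t - 1)" using b(3) that by auto
    moreover have "\<pi> ^ (t - 1) \<le> 1" using par by (intro power_le_one) auto
    then have "\<beta>\<^sub>1 * \<pi> ^ (t - 1) \<le> 1 * 1" using par by (intro mult_mono) auto
    ultimately show ?thesis using par by simp
  qed
  interpret fema_run d X \<phi> \<rho> q w \<psi>star D_inf P G G_inf T al b \<beta>\<^sub>2 \<beta>\<^sub>3 x\<^sub>0 qlo qhi U M \<xi>
  proof unfold_locales
    fix x y :: "nat \<Rightarrow> real" and t :: real assume xy: "x \<in> X" "y \<in> X" and t: "0 < t" "t < 1"
    have z: "(\<lambda>i. (1 - t) * x i + t * y i) \<in> X" using X(4) xy t by (auto simp: convex_set_def)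
    show "\<phi> (\<lambda>i. (1 - t) * x i + t * y i) \<le> (1 - t) * \<phi> x + t * \<phi> y + t * (1 - t) / 2 * wsq d (\<lambda>i. \<rho> * q i) y x"
      using weakly_convex_combination[OF wc q0 _ f_eq[OF xy(1)] _ f_eq[OF xy(2)] t] xy X(1) f_eq[OF z] by auto
  next
    fix x y assume xy: "x \<in> X" "y \<in> X"
    then show "\<phi> x + dot d (w x) (\<lambda>i. y i - x i) - 1 / 2 * wsq d (\<lambda>i. \<rho> * q i) y x \<le> \<phi> y"
      using par X(1) f_eq by (intro frechet_subgradient_inequality[OF wc _ q0 _ _ _ _ sub]) auto
  next
    fix y assume y: "y \<in> X"
    then have "ereal \<psi>star \<le> \<psi> y" using \<psi>star X(1) by auto
    then show "\<psi>star \<le> \<phi> y" using y by (simp add: \<psi> ext_fun_def)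
  next
    show "(\<lambda>(x, s). G x s) \<in> measurable (restrict_space borel U \<Otimes>\<^sub>M P) borel"
      using G by (simp add: stoch_subgradient_oracle_def)
  next
    fix x i assume "x \<in> X" "i < d"
    then show "integrable P (\<lambda>s. G x s i) \<and> (\<integral>s. G x s i \<partial>P) = w x i"
      using G XU by (auto simp: stoch_subgradient_oracle_def w_def)
  qed (use X D Gb G0 D0 par x\<^sub>0 q qhi qhi2 al b_range XU rnd in \<open>auto simp: fema_randomness_def\<close>)
  have h: "h = ext_fun X (\<lambda>_. 0)" by (simp add: h_def indicator_fun_ext)
  have ts_le: "ts \<omega> \<le> T" if "\<omega> \<in> space M" for \<omega> using rnd that by (simp add: fema_randomness_def)
  have grad: "sq_grad \<omega> = gsq (smp \<omega>) (ts \<omega>)" if \<omega>: "\<omega> \<in> space M" for \<omega>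
  proof -
    let ?t = "ts \<omega>"
    have sp: "smp \<omega> s \<in> space P" if "s < Suc ?t" for s
      using path_space[OF \<omega>, of s] ts_le[OF \<omega>] that by auto
    \<comment> \<open>\<open>fema_v\<close> at t is read off the state \<open>Suc t\<close>, so the
      metric in the claim is that of \<open>pn\<close>, not of \<open>pt\<close>.\<close>
    have v: "(\<lambda>i. sqrt (fema_v d h G q a b \<beta>\<^sub>2 \<beta>\<^sub>3 x\<^sub>0 (smp \<omega>) ?t i)) = as (smp \<omega>) (Suc ?t)"
      unfolding fema_v_def a h as_def vs_def st_def ..
    have x: "fema_x d h G q a b \<beta>\<^sub>2 \<beta>\<^sub>3 x\<^sub>0 (smp \<omega>) ?t = xs (smp \<omega>) ?t"
      unfolding fema_x_def a h xs_def st_def ..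
    have "grad_env d \<psi> (1 / (2 * \<rho>)) (as (smp \<omega>) (Suc ?t)) (xs (smp \<omega>) ?t)
        = (\<lambda>i. as (smp \<omega>) (Suc ?t) i / (1 / (2 * \<rho>)) * (xs (smp \<omega>) ?t i - pn (smp \<omega>) ?t i))"
      unfolding \<psi> pn_def
    proof (rule grad_env_eq[OF \<zeta>_pos])
      show "xs (smp \<omega>) ?t \<in> Rd d" using xs_X[of ?t "smp \<omega>"] sp ts_le[OF \<omega>] X(1) by auto
      fix i assume "i < d"
      then show "0 \<le> as (smp \<omega>) (Suc ?t) i \<and> \<rho> * q i < as (smp \<omega>) (Suc ?t) i / (1 / (2 * \<rho>))"
        using as_bounds(1)[of "Suc ?t" "smp \<omega>" i] sp ts_le[OF \<omega>] by (intro admissible) auto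
    qed
    then show ?thesis
      unfolding sq_grad_def v x gsq_def by (simp add: L2_set_def sum_nonneg)
  qed
  have unif: "M.prob {\<omega> \<in> space M. ts \<omega> = t} = 1 / (real T + 1)" if "t \<le> T" for t
    using rnd that al by (simp add: fema_randomness_def a)
  note ri = random_index[of ts "1 / (real T + 1)", OF _ ts_le unif]
  have int: "integrable M (\<lambda>\<omega>. gsq (smp \<omega>) (ts \<omega>))"
    and val: "(\<integral>\<omega>. gsq (smp \<omega>) (ts \<omega>) \<partial>M) = 1 / (real T + 1) * (\<Sum>t\<le>T. \<integral>\<omega>. gsq (smp \<omega>) t \<partial>M)"
    using ri rnd by (simp_all add: fema_randomness_def)
  define A' where "A' = sqrt (max qhi (G_inf\<^sup>2))"
  have A': "A = A'" "0 \<le> A'"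
    using qhi by (auto simp: A_def A'_def)
  define r where "r = sqrt (real T + 1)"
  have r: "1 \<le> r" "r\<^sup>2 = real T + 1" by (auto simp: r_def)
  have al_r: "al = \<alpha> / r" by (simp add: al_def r_def)
  define C1 where "C1 = \<bar>\<Delta>\<bar> + \<rho> * D_inf\<^sup>2 * A' + 4 * \<rho> * \<alpha> * G_inf * D_inf * (\<beta>\<^sub>1 * (1 + 1 / (1 - \<pi>)))
      + \<rho> * \<alpha>\<^sup>2 * G_inf\<^sup>2 / sqrt qlo"
  define C2 where "C2 = 2 * D_inf\<^sup>2 / \<kappa> * A'"
  define c1 where "c1 = 8 * \<rho>\<^sup>2 * A'\<^sup>2 / sqrt qlo"
  have C: "fema_const \<rho> \<alpha> \<pi> \<beta>\<^sub>1 D_inf G_inf qlo qhi \<Delta> = c1 * (C1 / (2 * \<rho>\<^sup>2 * \<kappa> * \<alpha>) + C2)"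
    unfolding fema_const_def c1_def C1_def C2_def \<kappa>_def A'_def ..
  have C1_0: "0 \<le> C1" unfolding C1_def using par G0 D0 A'(2) by (intro add_nonneg_nonneg) auto
  have C2_0: "0 \<le> C2" unfolding C2_def using \<kappa>_pos A'(2) by auto
  have c1_0: "0 \<le> c1" unfolding c1_def using par by auto
  have budget: "budget \<le> d * C1"
  proof -
    have "moreau_env d \<psi> (1 / (2 * \<rho>)) (\<lambda>i. sqrt (q i)) x\<^sub>0
        = ereal (obj (1 / (2 * \<rho>)) (\<lambda>i. sqrt (q i)) x\<^sub>0 (prox d (ext_fun X \<phi>) (1 / (2 * \<rho>)) (\<lambda>i. sqrt (q i)) x\<^sub>0))"
      unfolding \<psi> by (rule moreau_env_eq[OF \<zeta>_pos]) (simp add: q0)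
    then have e: "obj (1 / (2 * \<rho>)) (\<lambda>i. sqrt (q i)) x\<^sub>0 (prox d (ext_fun X \<phi>) (1 / (2 * \<rho>)) (\<lambda>i. sqrt (q i)) x\<^sub>0) - \<psi>star = \<Delta>"
      using \<Delta> by simp
    \<comment> \<open>The initial gap carries no factor d of its own; d \<ge> 1 supplies
      one.\<close>
    have "\<bar>\<Delta>\<bar> * 1 \<le> \<bar>\<Delta>\<bar> * d" using d by (intro mult_left_mono) auto
    then have 1: "\<Delta> \<le> d * \<bar>\<Delta>\<bar>" by (simp add: mult.commute)
    have "al \<le> \<alpha>" using par r by (simp add: al_def r_def[symmetric] divide_le_eq)
    moreover have "(\<Sum>t\<le>T. b t) \<le> \<beta>\<^sub>1 * (1 + 1 / (1 - \<pi>))"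
      using par b by (intro sum_decaying_momentum) auto
    moreover have "0 \<le> (\<Sum>t\<le>T. b t)" using b_range by (intro sum_nonneg) auto
    ultimately have 2: "4 * \<rho> * al * G_inf * D_inf * (\<Sum>t\<le>T. b t)
        \<le> 4 * \<rho> * \<alpha> * G_inf * D_inf * (\<beta>\<^sub>1 * (1 + 1 / (1 - \<pi>)))"
      using par G0 D0 al by (intro mult_mono) auto
    \<comment> \<open>The squared stepsizes sum to \<alpha>^2 whatever T is, so the squared steps
      contribute O(d) in total.\<close>
    have al2: "(real T + 1) * al\<^sup>2 = \<alpha>\<^sup>2" using r by (simp add: al_def power_divide)
    have "real (T + 1) * (\<rho> * al\<^sup>2 * G_inf\<^sup>2 / sqrt qlo)
        = \<rho> * ((real T + 1) * al\<^sup>2) * G_inf\<^sup>2 / sqrt qlo"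
      by (simp add: mult_ac)
    then have 3: "real (T + 1) * (\<rho> * al\<^sup>2 * G_inf\<^sup>2 / sqrt qlo) = \<rho> * \<alpha>\<^sup>2 * G_inf\<^sup>2 / sqrt qlo"
      unfolding al2 .
    have "budget = \<Delta> + d * (\<rho> * D_inf\<^sup>2 * A' + 4 * \<rho> * al * G_inf * D_inf * (\<Sum>t\<le>T. b t)
        + \<rho> * \<alpha>\<^sup>2 * G_inf\<^sup>2 / sqrt qlo)"
      unfolding budget_def e A'(1) 3 ..
    also have "\<dots> \<le> d * \<bar>\<Delta>\<bar> + d * (\<rho> * D_inf\<^sup>2 * A' + 4 * \<rho> * \<alpha> * G_inf * D_inf * (\<beta>\<^sub>1 * (1 + 1 / (1 - \<pi>)))
        + \<rho> * \<alpha>\<^sup>2 * G_inf\<^sup>2 / sqrt qlo)"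
      using 1 2 par(1) by (intro add_mono mult_left_mono) auto
    also have "\<dots> = d * C1" by (simp add: C1_def algebra_simps)
    finally show ?thesis .
  qed
  have "(\<Sum>t\<le>T. \<integral>\<omega>. gsq (smp \<omega>) t \<partial>M) \<le> c1 * (budget / (2 * \<rho>\<^sup>2 * \<kappa> * al) + 2 * D_inf\<^sup>2 / \<kappa> * (d * A'))"
    using sum_expectation_gsq_le unfolding c1_def A'(1) .
  also have "\<dots> \<le> c1 * (d * C1 / (2 * \<rho>\<^sup>2 * \<kappa> * al) + 2 * D_inf\<^sup>2 / \<kappa> * (d * A'))"
    using budget par \<kappa>_pos al c1_0 by (intro mult_left_mono add_mono divide_right_mono) auto
  \<comment> \<open>The factor r comes from dividing the budget by the stepsize \<alpha> / r. The
    switching term has none and is enlarged afterwards by r \<ge> 1.\<close>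
  also have "\<dots> = c1 * (d * (r * (C1 / (2 * \<rho>\<^sup>2 * \<kappa> * \<alpha>)) + C2))"
  proof -
    have "d * C1 / (2 * \<rho>\<^sup>2 * \<kappa> * al) = d * (r * (C1 / (2 * \<rho>\<^sup>2 * \<kappa> * \<alpha>)))"
      unfolding al_r by (simp add: mult_ac)
    moreover have "2 * D_inf\<^sup>2 / \<kappa> * (d * A') = d * C2"
      unfolding C2_def by (simp add: mult_ac)
    ultimately show ?thesis by (simp add: distrib_left)
  qed
  also have "\<dots> \<le> c1 * (d * (r * (C1 / (2 * \<rho>\<^sup>2 * \<kappa> * \<alpha>)) + r * C2))"
    using c1_0 C2_0 r mult_right_mono[of 1 r C2] by (intro mult_left_mono add_mono) auto
  finally have S: "(\<Sum>t\<le>T. \<integral>\<omega>. gsq (smp \<omega>) t \<partial>M) \<le> r * (fema_const \<rho> \<alpha> \<pi> \<beta>\<^sub>1 D_inf G_inf qlo qhi \<Delta> * d)"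
    unfolding C by (simp add: algebra_simps)
  have C0: "0 \<le> fema_const \<rho> \<alpha> \<pi> \<beta>\<^sub>1 D_inf G_inf qlo qhi \<Delta>"
    unfolding C using c1_0 C1_0 C2_0 \<kappa>_pos par by (intro mult_nonneg_nonneg add_nonneg_nonneg) auto
  have "(\<integral>\<omega>. sq_grad \<omega> \<partial>M) = 1 / (real T + 1) * (\<Sum>t\<le>T. \<integral>\<omega>. gsq (smp \<omega>) t \<partial>M)"
    using val by (simp add: Bochner_Integration.integral_cong[OF refl grad])
  also have "\<dots> \<le> 1 / (real T + 1) * (r * (fema_const \<rho> \<alpha> \<pi> \<beta>\<^sub>1 D_inf G_inf qlo qhi \<Delta> * d))"
    using S by (intro mult_left_mono) auto
  \<comment> \<open>The uniform weight is 1/r^2; against the factor r it leaves 1/r.\<close>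
  also have "\<dots> = fema_const \<rho> \<alpha> \<pi> \<beta>\<^sub>1 D_inf G_inf qlo qhi \<Delta> * (d / r)"
    unfolding r(2)[symmetric] using r(1) by (simp add: power2_eq_square)
  also have "\<dots> \<le> fema_const \<rho> \<alpha> \<pi> \<beta>\<^sub>1 D_inf G_inf qlo qhi \<Delta> * (d / sqrt (real T))"
    using C0 T by (intro mult_left_mono divide_left_mono) (auto simp: r_def)
  finally have "(\<integral>\<omega>. sq_grad \<omega> \<partial>M) \<le> \<dots>" .
  moreover have "integrable M sq_grad"
    using int by (simp add: Bochner_Integration.integrable_cong[OF refl grad])
  ultimately show ?thesis by blast
qed

theorem corollary10:
  fixes \<rho> \<alpha> \<pi> \<beta>\<^sub>1 \<beta>\<^sub>2 \<beta>\<^sub>3 D_inf G_inf qlo qhi \<Delta> :: real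
  assumes "0 < \<rho>" and "0 < \<alpha>" and "0 < \<pi>" and "\<pi> < 1"
    and "0 \<le> \<beta>\<^sub>1" and "\<beta>\<^sub>1 < 1"
    and "0 < \<beta>\<^sub>2" and "\<beta>\<^sub>2 < 1"
    and "0 \<le> \<beta>\<^sub>3" and "\<beta>\<^sub>3 < 1"
    and "\<beta>\<^sub>1 / sqrt \<beta>\<^sub>2 < 1"
    and "0 < qlo" and "qhi < 2 * sqrt qhi"
  shows "\<exists>C. \<forall>(d::nat) (T::nat) q f X U x\<^sub>0 \<psi>star (P :: 'a measure) G
              (b :: nat \<Rightarrow> real) (M :: 'w measure) \<xi> ts.
     let h = indicator_fun X;
         \<psi> = (\<lambda>x. f x + h x);
         a = (\<lambda>t::nat. \<alpha> / sqrt (real T + 1));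
         x = (\<lambda>\<omega>. fema_x d h G q a b \<beta>\<^sub>2 \<beta>\<^sub>3 x\<^sub>0 (\<lambda>t. \<xi> t \<omega>));
         v = (\<lambda>\<omega>. fema_v d h G q a b \<beta>\<^sub>2 \<beta>\<^sub>3 x\<^sub>0 (\<lambda>t. \<xi> t \<omega>));
         sq_grad = (\<lambda>\<omega>. (L2_set
           (grad_env d \<psi> (1 / (2 * \<rho>)) (\<lambda>i. sqrt (v \<omega> (ts \<omega>) i)) (x \<omega> (ts \<omega>))) {..<d})\<^sup>2)
     in
       0 < d \<longrightarrow> 0 < T \<longrightarrow>
       X \<subseteq> Rd d \<longrightarrow> X \<noteq> {} \<longrightarrow> closed X \<longrightarrow> convex_set X \<longrightarrow>
       q \<in> Rd d \<longrightarrow> (\<forall>i<d. qlo \<le> q i \<and> q i \<le> qhi) \<longrightarrow>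
       weakly_convex d \<rho> q f \<longrightarrow>
       (\<exists>z\<in>Rd d. \<psi> z = ereal \<psi>star) \<longrightarrow> (\<forall>z\<in>Rd d. ereal \<psi>star \<le> \<psi> z) \<longrightarrow>
       prob_space P \<longrightarrow>
       openin (top_of_set (Rd d)) U \<longrightarrow> X \<subseteq> U \<longrightarrow>
       stoch_subgradient_oracle d q f U P G \<longrightarrow>
       (\<forall>z\<in>X. \<forall>s\<in>space P. linf d (G z s) \<le> G_inf) \<longrightarrow>
       (\<forall>y\<in>X. \<forall>z\<in>X. linf d (\<lambda>i. y i - z i) \<le> D_inf) \<longrightarrow>
       0 \<le> b 0 \<longrightarrow> b 0 \<le> \<beta>\<^sub>1 \<longrightarrow> (\<forall>t\<in>{1..T}. b t = \<beta>\<^sub>1 * \<pi> ^ (t - 1)) \<longrightarrow>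
       x\<^sub>0 \<in> X \<longrightarrow>
       moreau_env d \<psi> (1 / (2 * \<rho>)) (\<lambda>i. sqrt (q i)) x\<^sub>0 - ereal \<psi>star = ereal \<Delta> \<longrightarrow>
       fema_randomness T a P M \<xi> ts \<longrightarrow>
       integrable M sq_grad \<and>
       (\<integral>\<omega>. sq_grad \<omega> \<partial>M) \<le> C * (real d / sqrt (real T))"
proof (intro exI[of _ "fema_const \<rho> \<alpha> \<pi> \<beta>\<^sub>1 D_inf G_inf qlo qhi \<Delta>"] allI, unfold Let_def, intro impI, goal_cases)
  case 1
  then show ?case by (intro fema_rate) (use assms in auto)
qed

end
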